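(* Let $\alpha\in(0,1)$ and define $$k_c=\sqrt{\frac{6(2-\alpha)}{\alpha(1-\alpha)}} .$$ Let $\mathcal{T}_\alpha$ be the triangulation of $\Omega=(-1,1)^2$ described in the context. Then for any $k\in\mathbb{R}\setminus\{0\}$ with $k\neq\pm k_c$, the Galerkin discretization of the Helmholtz problem with Robin boundary conditions by conforming piecewise linear elements on the mesh $\mathcal{T}_\alpha$ is well posed. For $k=\pm k_c$ the system matrix $\mathbf{A}_k$ is singular and its kernel has dimension one.
   Context: Let $\Omega=(-1,1)^2$, $\Gamma=\partial\Omega$. The mesh $\mathcal{T}_\alpha$ has the vertices $P_1^\Gamma=(-1,-1)$, $P_2^\Gamma=(1,-1)$, $P_3^\Gamma=(1,1)$, $P_4^\Gamma=(-1,1)$, $P_1^\Omega=(-\alpha,0)$, $P_2^\Omega=(0,-\alpha)$, $P_3^\Omega=(\alpha,0)$, $P_4^\Omega=(0,\alpha)$, $P_5^\Omega=(0,0)$, and consists of the 12 closed triangles with the following vertex sets: $\{P_4^\Gamma,P_1^\Gamma,P_1^\Omega\}$, $\{P_1^\Gamma,P_2^\Gamma,P_2^\Omega\}$, $\{P_2^\Gamma,P_3^\Gamma,P_3^\Omega\}$, $\{P_3^\Gamma,P_4^\Gamma,P_4^\Omega\}$; $\{P_1^\Gamma,P_1^\Omega,P_2^\Omega\}$, $\{P_2^\Gamma,P_2^\Omega,P_3^\Omega\}$, $\{P_3^\Gamma,P_3^\Omega,P_4^\Omega\}$, $\{P_4^\Gamma,P_4^\Omega,P_1^\Omega\}$;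 $\{P_5^\Omega,P_1^\Omega,P_2^\Omega\}$, $\{P_5^\Omega,P_2^\Omega,P_3^\Omega\}$, $\{P_5^\Omega,P_3^\Omega,P_4^\Omega\}$, $\{P_5^\Omega,P_4^\Omega,P_1^\Omega\}$. $S$ is the space of continuous (complex-valued) functions on $\Omega$ that are affine on each triangle. With $(u,v)=\int_\Omega u\overline v$ and $\langle u,v\rangle_\Gamma=\int_\Gamma u\overline v$, set $$a_k(u,v)=(\nabla u,\nabla v)-k^2(u,v)-\mathrm{i}k\langle u,v\rangle_\Gamma .$$ The Galerkin discretization is: given $F$, find $u_S\in S$ with $a_k(u_S,v)=F(v)$ for all $v\in S$. Well posed means uniquely solvable for every right-hand side. With $\mathcal{N}$ the set of the nine vertices and $(b_z)_{z\in\mathcal{N}}$ the nodal (hat function) basis of $S$, the system matrix is $\mathbf{A}_k=\big(a_k(b_z,b_y)\big)_{y,z\in\mathcal{N}}$, i.e. the $(y,z)$ entry is $(\nabla b_z,\nabla b_y)-k^2(b_z,b_y)-\mathrm{i}k\langle b_z,b_y\rangle_\Gamma$. *)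

theory Defs
  imports "HOL-Analysis.Analysis"
begin

type_synonym point = "real \<times> real"

definition dom :: "point set" where
  "dom = {-1<..<1} \<times> {-1<..<1}"

section \<open>The mesh\<close>

text \<open>
  The nine vertices are represented by labels, so that matrices over the nodes are
  ordinary library matrices \<open>complex ^ node ^ node\<close>. \<open>G1, \<dots>, G4\<close> are the vertices on the
  boundary, \<open>O1, \<dots>, O5\<close> the ones in the interior.
\<close>

datatype node = G1 | G2 | G3 | G4 | O1 | O2 | O3 | O4 | O5

lemma UNIV_node: "UNIV = {G1, G2, G3, G4, O1, O2, O3, O4, O5}"
  by (auto intro: node.exhaust)

instance node :: finite
  by standard (simp add: UNIV_node)

fun pos :: "real \<Rightarrow> node \<Rightarrow> point" where
  "pos \<alpha> G1 = (-1, -1)"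
| "pos \<alpha> G2 = (1, -1)"
| "pos \<alpha> G3 = (1, 1)"
| "pos \<alpha> G4 = (-1, 1)"
| "pos \<alpha> O1 = (-\<alpha>, 0)"
| "pos \<alpha> O2 = (0, -\<alpha>)"
| "pos \<alpha> O3 = (\<alpha>, 0)"
| "pos \<alpha> O4 = (0, \<alpha>)"
| "pos \<alpha> O5 = (0, 0)"

definition mesh :: "real \<Rightarrow> point set set" where
  "mesh \<alpha> = (\<lambda>V. convex hull (pos \<alpha> ` V)) `
     {{G4, G1, O1}, {G1, G2, O2}, {G2, G3, O3}, {G3, G4, O4},
      {G1, O1, O2}, {G2, O2, O3}, {G3, O3, O4}, {G4, O4, O1},
      {O5, O1, O2}, {O5, O2, O3}, {O5, O3, O4}, {O5, O4, O1}}"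

section \<open>The finite element space\<close>

definition affine_fun_on :: "point set \<Rightarrow> (point \<Rightarrow> complex) \<Rightarrow> bool" where
  "affine_fun_on T u \<longleftrightarrow> (\<exists>c f. linear f \<and> (\<forall>p\<in>T. u p = c + f p))"

text \<open>
  A continuous function on the open square that is affine on each triangle has a unique
  continuous extension to the closed square, which supplies its boundary values. An element
  of the space is this extension, made a total function by the value zero outside the
  closed square; in this way equality in the space is equality of HOL functions.
\<close>

definition fe_space :: "real \<Rightarrow> (point \<Rightarrow> complex) set" where
  "fe_space \<alpha> = {u. continuous_on (closure dom) u \<and>
     (\<forall>T\<in>mesh \<alpha>. affine_fun_on T u) \<and> (\<forall>p. p \<notin> closure dom \<longrightarrow> u p = 0)}"

definition hat :: "real \<Rightarrow> node \<Rightarrow> point \<Rightarrow> complex" where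
  "hat \<alpha> z = (THE b. b \<in> fe_space \<alpha> \<and> (\<forall>y. b (pos \<alpha> y) = (if y = z then 1 else 0)))"

section \<open>The sesquilinear form\<close>

definition L2_inner :: "(point \<Rightarrow> complex) \<Rightarrow> (point \<Rightarrow> complex) \<Rightarrow> complex" where
  "L2_inner u v = (LINT p:dom|lebesgue. u p * cnj (v p))"

text \<open>
  Elements of \<^const>\<open>fe_space\<close> are differentiable in the interior of each triangle, hence
  almost everywhere, and their weak gradient is the classical one. On the null set where the
  derivative does not exist the value of \<^const>\<open>frechet_derivative\<close> is irrelevant.
\<close>

definition grad_inner :: "(point \<Rightarrow> complex) \<Rightarrow> (point \<Rightarrow> complex) \<Rightarrow> complex" where
  "grad_inner u v = (LINT p:dom|lebesgue.
     (\<Sum>e\<in>Basis. frechet_derivative u (at p) e * cnj (frechet_derivative v (at p) e)))"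

text \<open>The integral over the boundary, each of the four sides parametrised by arc length.\<close>

definition boundary_integral :: "(point \<Rightarrow> complex) \<Rightarrow> complex" where
  "boundary_integral g =
     (LINT t:{-1..1}|lebesgue. g (t, -1)) + (LINT t:{-1..1}|lebesgue. g (1, t)) +
     (LINT t:{-1..1}|lebesgue. g (t, 1)) + (LINT t:{-1..1}|lebesgue. g (-1, t))"

definition boundary_inner :: "(point \<Rightarrow> complex) \<Rightarrow> (point \<Rightarrow> complex) \<Rightarrow> complex" where
  "boundary_inner u v = boundary_integral (\<lambda>p. u p * cnj (v p))"

definition helmholtz_form ::
    "real \<Rightarrow> (point \<Rightarrow> complex) \<Rightarrow> (point \<Rightarrow> complex) \<Rightarrow> complex" where
  "helmholtz_form k u v =
     grad_inner u v - (of_real k)\<^sup>2 * L2_inner u v - \<i> * of_real k * boundary_inner u v"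

section \<open>The Galerkin discretization\<close>

text \<open>
  The form is conjugate-linear in its second argument, so the right-hand sides are the
  conjugate-linear functionals on the space (automatically continuous, as its dimension is
  finite).
\<close>

definition antilinear_on ::
    "(point \<Rightarrow> complex) set \<Rightarrow> ((point \<Rightarrow> complex) \<Rightarrow> complex) \<Rightarrow> bool" where
  "antilinear_on S F \<longleftrightarrow>
     (\<forall>u\<in>S. \<forall>v\<in>S. F (\<lambda>p. u p + v p) = F u + F v) \<and>
     (\<forall>c. \<forall>v\<in>S. F (\<lambda>p. c * v p) = cnj c * F v)"

definition galerkin_well_posed :: "real \<Rightarrow> real \<Rightarrow> bool" where
  "galerkin_well_posed \<alpha> k \<longleftrightarrow>
     (\<forall>F. antilinear_on (fe_space \<alpha>) F \<longrightarrow>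
       (\<exists>!u. u \<in> fe_space \<alpha> \<and> (\<forall>v\<in>fe_space \<alpha>. helmholtz_form k u v = F v)))"

definition system_matrix :: "real \<Rightarrow> real \<Rightarrow> complex ^ node ^ node" where
  "system_matrix \<alpha> k = (\<chi> y z. helmholtz_form k (hat \<alpha> z) (hat \<alpha> y))"

definition k_crit :: "real \<Rightarrow> real" where
  "k_crit \<alpha> = sqrt (6 * (2 - \<alpha>) / (\<alpha> * (1 - \<alpha>)))"

end

theory Submission
  imports Defs
begin

text \<open>
  Why the statement is true. A function of the finite element space is determined by its nine
  nodal values, and on each of the twelve triangles the integrals in the form can be written in
  terms of the three nodal values of that triangle. So the form is an explicit sesquilinear
  form on vectors of nodal values (\<open>helmholtz_form_eq\<close>), the discrete problem is a linear
  system with the system matrix, and well posedness means that this matrix has trivial kernel.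

  The kernel is found in two steps (\<open>discrete_form_kernel\<close>). First, testing a kernel vector
  \<open>x\<close> with itself and taking imaginary parts leaves only \<open>- k\<close> times the
  squared boundary norm, because the stiffness and the mass terms are real. For \<open>k \<noteq> 0\<close> all
  corner values vanish. Secondly, the equation of a corner couples only the two neighbouring
  values on the inner ring \<open>O1, \<dots>, O4\<close>, with a common coefficient that is negative for every
  \<open>k\<close>. Adjacent ring values are therefore opposite, so the ring carries a multiple of the
  alternating vector \<open>(1, -1, 1, -1)\<close>. Adding the equations of two adjacent ring nodes makes
  the alternating part cancel and leaves a multiple, again with a negative coefficient, of the
  value at the centre \<open>O5\<close>, which hence vanishes. What remains of the equations is one scalar
  condition on the multiple of the alternating vector: its coefficient is
  \<open>(2 - \<alpha>) / (\<alpha> (1 - \<alpha>)) - k\<^sup>2 / 6\<close>, which is zero exactly for \<open>k = \<plusminus> k_crit \<alpha>\<close>. So the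
  kernel is trivial for the other \<open>k \<noteq> 0\<close> and is the line spanned by the alternating vector
  at the critical wave numbers.

  Three facts carry the passage from the integrals to this finite problem. The area
  formula for affine maps of the plane gives the exact integral over a triangle of the product of
  two affine functions (\<open>has_bochner_integral_triangle\<close>). The triangles cover the square and
  their areas add up to the area of the square, so their overlaps are null sets
  (\<open>AE_indicator_dom_eq_sum_triangles\<close>). Finally, nodal values can be prescribed
  (\<open>has_nodal_function\<close>), since hat functions arise from maxima and minima of affine functions.
\<close>

section \<open>Integration over triangles in the plane\<close>

text \<open>
  Twice the signed area of the triangle \<open>A B C\<close>.
\<close>

definition orient :: "real \<times> real \<Rightarrow> real \<times> real \<Rightarrow> real \<times> real \<Rightarrow> real" where
  "orient A B C = (fst B - fst A) * (snd C - snd A) - (snd B - snd A) * (fst C - fst A)"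

text \<open>
  If the coefficient \<open>a\<close> of the affine map is nonzero, the map is a composition of two maps that
  change one coordinate each, so the formula follows from Fubini's theorem and the one-dimensional
  substitution rule, applied first to the vertical and then to the horizontal integral.
\<close>

lemma nn_integral_affine_plane_aux:
  fixes f :: "real \<times> real \<Rightarrow> ennreal" and x0 y0 a b c d :: real
  assumes f [measurable]: "f \<in> borel_measurable borel"
    and a: "a \<noteq> 0" and D: "a * d - b * c \<noteq> 0"
  shows "(\<integral>\<^sup>+p. f p \<partial>lborel) = ennreal \<bar>a * d - b * c\<bar> *
    (\<integral>\<^sup>+q. f (x0 + a * fst q + b * snd q, y0 + c * fst q + d * snd q) \<partial>lborel)"
proof -
  \<comment> \<open>For a fixed first coordinate, moving the parameter \<open>t\<close> by one moves the second coordinate by \<open>e\<close>.\<close>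
  define e where "e = (a * d - b * c) / a"
  have e: "e \<noteq> 0" using a D by (simp add: e_def)
  have f' [measurable]: "f \<in> borel_measurable (lborel \<Otimes>\<^sub>M lborel)"
    by (simp add: lborel_prod)
  have "(\<integral>\<^sup>+p. f p \<partial>lborel) = (\<integral>\<^sup>+x. \<integral>\<^sup>+y. f (x, y) \<partial>lborel \<partial>lborel)"
    by (simp add: lborel.nn_integral_fst lborel_prod)
  also have "\<dots> = (\<integral>\<^sup>+x. ennreal \<bar>e\<bar> *
      (\<integral>\<^sup>+t. f (x, (y0 + c / a * (x - x0)) + e * t) \<partial>lborel) \<partial>lborel)"
    by (intro nn_integral_cong nn_integral_real_affine e) measurable
  also have "\<dots> = ennreal \<bar>e\<bar> *
      (\<integral>\<^sup>+x. \<integral>\<^sup>+t. f (x, (y0 + c / a * (x - x0)) + e * t) \<partial>lborel \<partial>lborel)"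
    by (intro nn_integral_cmult) measurable
  also have "(\<integral>\<^sup>+x. \<integral>\<^sup>+t. f (x, (y0 + c / a * (x - x0)) + e * t) \<partial>lborel \<partial>lborel) =
      (\<integral>\<^sup>+t. \<integral>\<^sup>+x. f (x, (y0 + c / a * (x - x0)) + e * t) \<partial>lborel \<partial>lborel)"
    by (rule lborel_pair.Fubini') measurable
  also have "\<dots> = (\<integral>\<^sup>+t. ennreal \<bar>a\<bar> * (\<integral>\<^sup>+s. f ((x0 + b * t) + a * s,
      (y0 + c / a * (((x0 + b * t) + a * s) - x0)) + e * t) \<partial>lborel) \<partial>lborel)"
    by (intro nn_integral_cong
        nn_integral_real_affine[where f = "\<lambda>x. f (x, (y0 + c / a * (x - x0)) + e * t)" for t] a) measurable
  also have "\<dots> = (\<integral>\<^sup>+t. ennreal \<bar>a\<bar> *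
      (\<integral>\<^sup>+s. f (x0 + a * s + b * t, y0 + c * s + d * t) \<partial>lborel) \<partial>lborel)"
  proof -
    have "(y0 + c / a * (((x0 + b * t) + a * s) - x0)) + e * t = y0 + c * s + d * t" for s t
      using a by (simp add: e_def field_simps)
    then show ?thesis by (simp add: ac_simps)
  qed
  also have "\<dots> = ennreal \<bar>a\<bar> *
      (\<integral>\<^sup>+t. \<integral>\<^sup>+s. f (x0 + a * s + b * t, y0 + c * s + d * t) \<partial>lborel \<partial>lborel)"
    by (intro nn_integral_cmult) measurable
  also have "(\<integral>\<^sup>+t. \<integral>\<^sup>+s. f (x0 + a * s + b * t, y0 + c * s + d * t) \<partial>lborel \<partial>lborel) =
     (\<integral>\<^sup>+q. f (x0 + a * fst q + b * snd q, y0 + c * fst q + d * snd q) \<partial>lborel)"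
    by (subst lborel_prod[symmetric], subst lborel_pair.nn_integral_snd[symmetric]) simp_all
  also have "ennreal \<bar>e\<bar> * (ennreal \<bar>a\<bar> * X) = ennreal \<bar>a * d - b * c\<bar> * X" for X
  proof -
    have "\<bar>e\<bar> * \<bar>a\<bar> = \<bar>a * d - b * c\<bar>"
      using a by (simp add: e_def abs_divide)
    then show ?thesis by (simp add: mult.assoc[symmetric] ennreal_mult[symmetric])
  qed
  finally show ?thesis .
qed

text \<open>
  When \<open>a = 0\<close>, the determinant forces \<open>b \<noteq> 0\<close>, and exchanging the two parameters reduces
  to the previous case. Triangles whose first two vertices span a vertical edge need this.
\<close>

lemma nn_integral_affine_plane:
  fixes f :: "real \<times> real \<Rightarrow> ennreal" and x0 y0 a b c d :: real
  assumes f [measurable]: "f \<in> borel_measurable borel" and D: "a * d - b * c \<noteq> 0"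
  shows "(\<integral>\<^sup>+p. f p \<partial>lborel) = ennreal \<bar>a * d - b * c\<bar> *
    (\<integral>\<^sup>+q. f (x0 + a * fst q + b * snd q, y0 + c * fst q + d * snd q) \<partial>lborel)"
proof (cases "a = 0")
  case False
  then show ?thesis using nn_integral_affine_plane_aux[OF f False D] by simp
next
  case True
  then have b: "b \<noteq> 0" and D': "b * c - a * d \<noteq> 0" using D by auto
  have f' [measurable]: "f \<in> borel_measurable (lborel \<Otimes>\<^sub>M lborel)"
    by (simp add: lborel_prod)
  have "(\<integral>\<^sup>+q. f (x0 + b * fst q + a * snd q, y0 + d * fst q + c * snd q) \<partial>lborel) =
      (\<integral>\<^sup>+s. \<integral>\<^sup>+t. f (x0 + b * s + a * t, y0 + d * s + c * t) \<partial>lborel \<partial>lborel)"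
    by (subst lborel_prod[symmetric], subst lborel.nn_integral_fst[symmetric]) simp_all
  also have "\<dots> = (\<integral>\<^sup>+q. f (x0 + a * fst q + b * snd q, y0 + c * fst q + d * snd q) \<partial>lborel)"
    by (subst lborel_prod[symmetric], subst lborel_pair.nn_integral_snd[symmetric])
      (simp_all add: ac_simps)
  finally show ?thesis
    using nn_integral_affine_plane_aux[OF f b D', of x0 y0] by (simp add: abs_minus_commute)
qed

lemma lborel_affine_plane:
  fixes x0 y0 a b c d :: real
  assumes D: "a * d - b * c \<noteq> 0"
  defines "\<phi> \<equiv> \<lambda>q. (x0 + a * fst q + b * snd q, y0 + c * fst q + d * snd q)"
  shows "lborel = density (distr lborel borel \<phi>) (\<lambda>_. ennreal \<bar>a * d - b * c\<bar>)"
proof (rule measure_eqI)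
  have [measurable]: "\<phi> \<in> borel_measurable borel"
    unfolding \<phi>_def by (intro borel_measurable_continuous_onI continuous_intros)
  fix A :: "(real \<times> real) set" assume "A \<in> sets lborel"
  then have [measurable]: "A \<in> sets borel" by simp
  have "emeasure lborel A = (\<integral>\<^sup>+p. indicator A p \<partial>lborel)" by simp
  also have "\<dots> = ennreal \<bar>a * d - b * c\<bar> * (\<integral>\<^sup>+q. indicator A (\<phi> q) \<partial>lborel)"
    unfolding \<phi>_def by (rule nn_integral_affine_plane) (use D in auto)
  also have "\<dots> = emeasure (density (distr lborel borel \<phi>) (\<lambda>_. ennreal \<bar>a * d - b * c\<bar>)) A"
  proof -
    have "(\<integral>\<^sup>+q. indicator A (\<phi> q) \<partial>lborel) = (\<integral>\<^sup>+p. indicator A p \<partial>distr lborel borel \<phi>)"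
      by (rule nn_integral_distr[symmetric]) measurable
    then show ?thesis by (simp add: emeasure_density nn_integral_cmult_indicator)
  qed
  finally show "emeasure lborel A = \<dots>" .
qed simp

lemma has_bochner_integral_affine_plane:
  fixes f :: "real \<times> real \<Rightarrow> 'a::{banach, second_countable_topology}"
  assumes f [measurable]: "f \<in> borel_measurable borel" and D: "a * d - b * c \<noteq> 0"
    and I: "has_bochner_integral lborel
      (\<lambda>q. f (x0 + a * fst q + b * snd q, y0 + c * fst q + d * snd q)) I"
  shows "has_bochner_integral lborel f (\<bar>a * d - b * c\<bar> *\<^sub>R I)"
proof -
  let ?\<phi> = "\<lambda>q. (x0 + a * fst q + b * snd q, y0 + c * fst q + d * snd q)"
  have [measurable]: "?\<phi> \<in> borel_measurable borel"
    by (intro borel_measurable_continuous_onI continuous_intros)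
  have "has_bochner_integral (density (distr lborel borel ?\<phi>) (\<lambda>_. ennreal \<bar>a * d - b * c\<bar>)) f
     (\<bar>a * d - b * c\<bar> *\<^sub>R I)"
    using I by (intro has_bochner_integral_density has_bochner_integral_distr
        has_bochner_integral_scaleR_right) auto
  then show ?thesis by (simp only: lborel_affine_plane[OF D, symmetric])
qed

definition std_simplex :: "(real \<times> real) set" where
  "std_simplex = {q. 0 \<le> fst q \<and> 0 \<le> snd q \<and> fst q + snd q \<le> 1}"

lemma std_simplex_borel [measurable]: "std_simplex \<in> sets borel"
  unfolding std_simplex_def
  by (intro borel_closed closed_Collect_conj closed_Collect_le continuous_intros)

text \<open>
  Integrating \<open>x^i y^j\<close> first over \<open>0 \<le> y \<le> 1 - x\<close> leaves a polynomial in \<open>x\<close>. Its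
  antiderivative \<open>F\<close> is a parameter, which keeps the value concrete for each of the six
  monomials of degree at most two.
\<close>

lemma has_bochner_integral_std_simplex_monomial:
  fixes F :: "real \<Rightarrow> real"
  assumes F: "\<And>x. (F has_real_derivative x ^ i * (1 - x) ^ Suc j / real (Suc j)) (at x)"
  shows "has_bochner_integral lborel
    (\<lambda>q. indicator std_simplex q * (fst q ^ i * snd q ^ j)) (F 1 - F 0)"
proof (rule has_bochner_integral_nn_integral)
  show meas [measurable]: "(\<lambda>q. indicator std_simplex q * (fst q ^ i * snd q ^ j) :: real) \<in> borel_measurable lborel"
  proof -
    have "(\<lambda>q :: real \<times> real. fst q ^ i * snd q ^ j) \<in> borel_measurable borel"
      by (intro borel_measurable_continuous_onI continuous_intros)
    then show ?thesis by (auto intro!: borel_measurable_times borel_measurable_indicator)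
  qed
  let ?g = "\<lambda>x. x ^ i * (1 - x) ^ Suc j / real (Suc j)"
  have g0: "0 \<le> ?g x" if "0 \<le> x" "x \<le> 1" for x :: real using that by simp
  have "F 0 \<le> F 1" by (rule DERIV_nonneg_imp_nondecreasing) (use F g0 in fastforce)+
  then show "0 \<le> F 1 - F 0" by simp
  have inner: "(\<integral>\<^sup>+y. ennreal (indicator std_simplex (x, y) * (x ^ i * y ^ j)) \<partial>lborel) =
      ennreal (?g x) * indicator {0..1} x" for x
  proof (cases "x \<in> {0..1}")
    case True
    have "(\<integral>\<^sup>+y. ennreal (indicator std_simplex (x, y) * (x ^ i * y ^ j)) \<partial>lborel) =
        (\<integral>\<^sup>+y. ennreal (x ^ i * y ^ j) * indicator {0..1 - x} y \<partial>lborel)"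
      using True by (intro nn_integral_cong) (auto simp: std_simplex_def indicator_def)
    also have "\<dots> = ennreal (x ^ i * ((1 - x) ^ Suc j / real (Suc j)) - x ^ i * (0 ^ Suc j / real (Suc j)))"
    proof (rule nn_integral_FTC_Icc)
      show "((\<lambda>y. x ^ i * (y ^ Suc j / real (Suc j))) has_real_derivative x ^ i * y ^ j) (at y)" for y
        using DERIV_power_Suc[OF DERIV_ident, of j y UNIV] DERIV_cmult[OF DERIV_cdivide]
        by (rule_tac DERIV_cmult) (auto intro!: derivative_eq_intros simp del: power_Suc)
    qed (use True in auto)
    finally show ?thesis using True by simp
  next
    case False
    then have "(indicator std_simplex (x, y) :: real) = 0" for y
      by (auto simp: std_simplex_def indicator_def)
    with False show ?thesis by simp
  qed
  have "(\<integral>\<^sup>+q. ennreal (indicator std_simplex q * (fst q ^ i * snd q ^ j)) \<partial>lborel) =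
      (\<integral>\<^sup>+x. \<integral>\<^sup>+y. ennreal (indicator std_simplex (x, y) * (x ^ i * y ^ j)) \<partial>lborel \<partial>lborel)"
    by (subst lborel_prod[symmetric], subst lborel.nn_integral_fst[symmetric])
      (use meas in \<open>simp_all add: lborel_prod\<close>)
  also have "\<dots> = (\<integral>\<^sup>+x. ennreal (?g x) * indicator {0..1} x \<partial>lborel)"
    by (simp add: inner)
  also have "\<dots> = ennreal (F 1 - F 0)"
    by (intro nn_integral_FTC_Icc) (use F g0 in auto)
  finally show "(\<integral>\<^sup>+q. ennreal (indicator std_simplex q * (fst q ^ i * snd q ^ j)) \<partial>lborel) =
    ennreal (F 1 - F 0)" .
  show "AE q in lborel. 0 \<le> indicator std_simplex q * (fst q ^ i * snd q ^ j)"
    by (auto simp: std_simplex_def indicator_def)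
qed

lemma has_bochner_integral_std_simplex_affine_product:
  fixes a u v b w z :: complex
  shows "has_bochner_integral lborel
    (\<lambda>q. indicator std_simplex q *\<^sub>R
       ((a + of_real (fst q) * u + of_real (snd q) * v) * (b + of_real (fst q) * w + of_real (snd q) * z)))
    (a * b / 2 + (a * w + u * b + a * z + v * b) / 6 + (u * w + v * z) / 12 + (u * z + v * w) / 24)"
proof -
  have m: "has_bochner_integral lborel
      (\<lambda>q. of_real (indicator std_simplex q * (fst q ^ i * snd q ^ j)) * (c :: complex)) (of_real (F 1 - F 0) * c)"
    if "\<And>x. (F has_real_derivative x ^ i * (1 - x) ^ Suc j / real (Suc j)) (at x)" for F i j c
    by (intro has_bochner_integral_mult_left has_bochner_integral_of_real
        has_bochner_integral_std_simplex_monomial that)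
  have M00: "has_bochner_integral lborel
      (\<lambda>q. of_real (indicator std_simplex q * (fst q ^ 0 * snd q ^ 0)) * c) (of_real (1/2) * c)" for c :: complex
  proof -
    have "((\<lambda>x. x - x^2/2) has_real_derivative x ^ 0 * (1 - x) ^ Suc 0 / real (Suc 0)) (at x)" for x
      by (auto intro!: derivative_eq_intros simp: field_simps power2_eq_square power3_eq_cube power4_eq_xxxx)
    from m[OF this] show ?thesis by simp
  qed
  have M01: "has_bochner_integral lborel
      (\<lambda>q. of_real (indicator std_simplex q * (fst q ^ 0 * snd q ^ 1)) * c) (of_real (1/6) * c)" for c :: complex
  proof -
    have "((\<lambda>x. x/2 - x^2/2 + x^3/6) has_real_derivative x ^ 0 * (1 - x) ^ Suc 1 / real (Suc 1)) (at x)" for x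
      by (auto intro!: derivative_eq_intros simp: field_simps power2_eq_square power3_eq_cube power4_eq_xxxx)
    from m[OF this] show ?thesis by simp
  qed
  have M02: "has_bochner_integral lborel
      (\<lambda>q. of_real (indicator std_simplex q * (fst q ^ 0 * snd q ^ 2)) * c) (of_real (1/12) * c)" for c :: complex
  proof -
    have "((\<lambda>x. x/3 - x^2/2 + x^3/3 - x^4/12) has_real_derivative x ^ 0 * (1 - x) ^ Suc 2 / real (Suc 2)) (at x)" for x
      by (auto intro!: derivative_eq_intros simp: field_simps power2_eq_square power3_eq_cube power4_eq_xxxx)
    from m[OF this] show ?thesis by simp
  qed
  have M10: "has_bochner_integral lborel
      (\<lambda>q. of_real (indicator std_simplex q * (fst q ^ 1 * snd q ^ 0)) * c) (of_real (1/6) * c)" for c :: complex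
  proof -
    have "((\<lambda>x. x^2/2 - x^3/3) has_real_derivative x ^ 1 * (1 - x) ^ Suc 0 / real (Suc 0)) (at x)" for x
      by (auto intro!: derivative_eq_intros simp: field_simps power2_eq_square power3_eq_cube power4_eq_xxxx)
    from m[OF this] show ?thesis by simp
  qed
  have M11: "has_bochner_integral lborel
      (\<lambda>q. of_real (indicator std_simplex q * (fst q ^ 1 * snd q ^ 1)) * c) (of_real (1/24) * c)" for c :: complex
  proof -
    have "((\<lambda>x. x^2/4 - x^3/3 + x^4/8) has_real_derivative x ^ 1 * (1 - x) ^ Suc 1 / real (Suc 1)) (at x)" for x
      by (auto intro!: derivative_eq_intros simp: field_simps power2_eq_square power3_eq_cube power4_eq_xxxx)
    from m[OF this] show ?thesis by simp
  qed
  have M20: "has_bochner_integral lborel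
      (\<lambda>q. of_real (indicator std_simplex q * (fst q ^ 2 * snd q ^ 0)) * c) (of_real (1/12) * c)" for c :: complex
  proof -
    have "((\<lambda>x. x^3/3 - x^4/4) has_real_derivative x ^ 2 * (1 - x) ^ Suc 0 / real (Suc 0)) (at x)" for x
      by (auto intro!: derivative_eq_intros simp: field_simps power2_eq_square power3_eq_cube power4_eq_xxxx)
    from m[OF this] show ?thesis by simp
  qed
  have "has_bochner_integral lborel (\<lambda>q.
      of_real (indicator std_simplex q * (fst q ^ 0 * snd q ^ 0)) * (a * b) +
      of_real (indicator std_simplex q * (fst q ^ 1 * snd q ^ 0)) * (a * w + u * b) +
      of_real (indicator std_simplex q * (fst q ^ 0 * snd q ^ 1)) * (a * z + v * b) +
      of_real (indicator std_simplex q * (fst q ^ 2 * snd q ^ 0)) * (u * w) +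
      of_real (indicator std_simplex q * (fst q ^ 0 * snd q ^ 2)) * (v * z) +
      of_real (indicator std_simplex q * (fst q ^ 1 * snd q ^ 1)) * (u * z + v * w))
     (of_real (1/2) * (a * b) + of_real (1/6) * (a * w + u * b) + of_real (1/6) * (a * z + v * b) +
      of_real (1/12) * (u * w) + of_real (1/12) * (v * z) + of_real (1/24) * (u * z + v * w))"
    by (intro has_bochner_integral_add M00 M01 M10 M02 M11 M20)
  then show ?thesis
    by (rule has_bochner_integral_cong[THEN iffD1, rotated -1])
      (simp_all add: indicator_def algebra_simps power2_eq_square add_divide_distrib)
qed

lemma orient_barycentric: "orient A B C = orient P B C + orient A P C + orient A B P"
  by (simp add: orient_def algebra_simps)

section \<open>Affine functions on a triangle\<close>

lemma convex_hull_3_param: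
  "convex hull {A, B, C} = (\<lambda>q. A + fst q *\<^sub>R (B - A) + snd q *\<^sub>R (C - A)) ` std_simplex"
  unfolding convex_hull_3_alt std_simplex_def image_def by auto

text \<open>
  The three orientations are the barycentric coordinates of \<open>P\<close> up to the positive factor
  \<open>orient A B C\<close>.
\<close>

lemma in_convex_hull_3I:
  assumes D: "orient A B C > 0"
    and "orient P B C \<ge> 0" "orient A P C \<ge> 0" "orient A B P \<ge> 0"
  shows "P \<in> convex hull {A, B, C}"
proof -
  define s t where "s = orient A P C / orient A B C" and "t = orient A B P / orient A B C"
  have "fst P = fst A + s * (fst B - fst A) + t * (fst C - fst A)"
    "snd P = snd A + s * (snd B - snd A) + t * (snd C - snd A)"
    using D unfolding s_def t_def by (simp_all add: field_simps) (simp_all add: orient_def algebra_simps)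
  then have P: "P = A + s *\<^sub>R (B - A) + t *\<^sub>R (C - A)"
    by (simp add: prod_eq_iff)
  have "s + t \<le> 1"
    using assms orient_barycentric[of A B C P]
    by (simp add: s_def t_def add_divide_distrib[symmetric])
  then have "(s, t) \<in> std_simplex"
    using assms by (simp add: std_simplex_def s_def t_def)
  with P show ?thesis unfolding convex_hull_3_param by force
qed

lemma affine_fun_on_param:
  assumes "affine_fun_on T u"
    and "A \<in> T" "B \<in> T" "C \<in> T" "A + s *\<^sub>R (B - A) + t *\<^sub>R (C - A) \<in> T"
  shows "u (A + s *\<^sub>R (B - A) + t *\<^sub>R (C - A)) =
    u A + of_real s * (u B - u A) + of_real t * (u C - u A)"
proof -
  obtain c f where f: "linear f" and u: "\<And>p. p \<in> T \<Longrightarrow> u p = c + f p"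
    using assms(1) unfolding affine_fun_on_def by blast
  show ?thesis
    using assms(2-) by (simp add: u linear_add[OF f] linear_diff[OF f] linear_cmul[OF f] scaleR_conv_of_real)
qed

text \<open>
  The local mass matrix. The parametrisation of the triangle over the standard simplex turns both
  functions into affine functions of the parameters, and its Jacobian determinant is
  \<open>orient A B C\<close>.
\<close>

lemma has_bochner_integral_triangle:
  fixes u v :: "real \<times> real \<Rightarrow> complex"
  assumes D: "orient A B C \<noteq> 0"
    and u: "affine_fun_on (convex hull {A, B, C}) u" and v: "affine_fun_on (convex hull {A, B, C}) v"
  shows "has_bochner_integral lborel (\<lambda>p. indicator (convex hull {A, B, C}) p *\<^sub>R (u p * cnj (v p)))
    (of_real \<bar>orient A B C\<bar> / 24 * ((u A + u B + u C) * cnj (v A + v B + v C) +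
       u A * cnj (v A) + u B * cnj (v B) + u C * cnj (v C)))"
proof -
  let ?T = "convex hull {A, B, C}"
  let ?\<phi> = "\<lambda>q. (fst A + (fst B - fst A) * fst q + (fst C - fst A) * snd q,
    snd A + (snd B - snd A) * fst q + (snd C - snd A) * snd q)"
  have \<phi>: "?\<phi> = (\<lambda>q. A + fst q *\<^sub>R (B - A) + snd q *\<^sub>R (C - A))"
    by (simp add: prod_eq_iff fun_eq_iff algebra_simps)
  have ne: "(fst B - fst A) * (snd C - snd A) - (fst C - fst A) * (snd B - snd A) \<noteq> 0"
    using D by (simp add: orient_def algebra_simps)
  have T: "?T = ?\<phi> ` std_simplex" unfolding \<phi> by (rule convex_hull_3_param)
  \<comment> \<open>Injectivity turns the indicator of the triangle into the indicator of the simplex.\<close>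
  have inj: "inj ?\<phi>"
  proof (rule injI)
    fix p q assume "?\<phi> p = ?\<phi> q"
    then have 1: "(fst B - fst A) * (fst p - fst q) + (fst C - fst A) * (snd p - snd q) = 0"
      "(snd B - snd A) * (fst p - fst q) + (snd C - snd A) * (snd p - snd q) = 0"
      by (simp_all add: algebra_simps)
    from 1 have "orient A B C * (fst p - fst q) = 0" "orient A B C * (snd p - snd q) = 0"
      unfolding orient_def by algebra+
    with D show "p = q" by (simp add: prod_eq_iff)
  qed
  then have mem: "?\<phi> q \<in> ?T \<longleftrightarrow> q \<in> std_simplex" for q
    unfolding T by (rule inj_image_mem_iff)
  \<comment> \<open>Nothing is known about the functions off the triangle, so they are replaced by globally affine ones.\<close>
  have meas: "(\<lambda>p. indicator ?T p *\<^sub>R (u p * cnj (v p))) \<in> borel_measurable borel"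
  proof -
    obtain c f c' f' where f: "linear f" "linear f'"
      and uv: "\<And>p. p \<in> ?T \<Longrightarrow> u p = c + f p" "\<And>p. p \<in> ?T \<Longrightarrow> v p = c' + f' p"
      using u v unfolding affine_fun_on_def by metis
    have "compact ?T" by (intro finite_imp_compact_convex_hull) simp
    then have "?T \<in> sets borel" by (simp add: compact_imp_closed)
    moreover have "(\<lambda>p. (c + f p) * cnj (c' + f' p)) \<in> borel_measurable borel"
      using f by (intro borel_measurable_continuous_onI continuous_intros)
        (auto intro: linear_continuous_on simp: linear_conv_bounded_linear)
    ultimately have "(\<lambda>p. indicator ?T p *\<^sub>R ((c + f p) * cnj (c' + f' p))) \<in> borel_measurable borel"
      by (intro borel_measurable_scaleR borel_measurable_indicator)
    also have "(\<lambda>p. indicator ?T p *\<^sub>R ((c + f p) * cnj (c' + f' p))) =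
        (\<lambda>p. indicator ?T p *\<^sub>R (u p * cnj (v p)))"
      by (auto simp: uv indicator_def fun_eq_iff)
    finally show ?thesis .
  qed
  have vert: "A \<in> ?T" "B \<in> ?T" "C \<in> ?T" by (auto intro: hull_inc)
  have "indicator ?T (?\<phi> q) *\<^sub>R (u (?\<phi> q) * cnj (v (?\<phi> q))) =
     indicator std_simplex q *\<^sub>R
       ((u A + of_real (fst q) * (u B - u A) + of_real (snd q) * (u C - u A)) *
        (cnj (v A) + of_real (fst q) * cnj (v B - v A) + of_real (snd q) * cnj (v C - v A)))" for q
  proof (cases "q \<in> std_simplex")
    case True
    then have q: "?\<phi> q \<in> ?T" using mem by simp
    have *: "u (?\<phi> q) = u A + of_real (fst q) * (u B - u A) + of_real (snd q) * (u C - u A)"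
      "v (?\<phi> q) = v A + of_real (fst q) * (v B - v A) + of_real (snd q) * (v C - v A)"
      using affine_fun_on_param[OF u vert, of "fst q" "snd q"]
        affine_fun_on_param[OF v vert, of "fst q" "snd q"] q
      unfolding fun_cong[OF \<phi>, of q] by blast+
    show ?thesis using True q unfolding * by simp
  qed (use mem in simp)
  then have "has_bochner_integral lborel
     (\<lambda>q. indicator ?T (?\<phi> q) *\<^sub>R (u (?\<phi> q) * cnj (v (?\<phi> q))))
     (u A * cnj (v A) / 2 + (u A * cnj (v B - v A) + (u B - u A) * cnj (v A) +
         u A * cnj (v C - v A) + (u C - u A) * cnj (v A)) / 6 +
      ((u B - u A) * cnj (v B - v A) + (u C - u A) * cnj (v C - v A)) / 12 +
      ((u B - u A) * cnj (v C - v A) + (u C - u A) * cnj (v B - v A)) / 24)" (is "has_bochner_integral _ _ ?I")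
    by (simp only: has_bochner_integral_std_simplex_affine_product)
  from has_bochner_integral_affine_plane[OF meas ne this]
  have "has_bochner_integral lborel (\<lambda>p. indicator ?T p *\<^sub>R (u p * cnj (v p)))
      (\<bar>(fst B - fst A) * (snd C - snd A) - (fst C - fst A) * (snd B - snd A)\<bar> *\<^sub>R ?I)" .
  also have "(fst B - fst A) * (snd C - snd A) - (fst C - fst A) * (snd B - snd A) = orient A B C"
    by (simp add: orient_def algebra_simps)
  also have "?I = ((u A + u B + u C) * cnj (v A + v B + v C) +
       u A * cnj (v A) + u B * cnj (v B) + u C * cnj (v C)) / 24" by (simp add: field_simps)
  finally show ?thesis by (simp add: scaleR_conv_of_real)
qed

lemma frechet_derivative_affine_interior:
  fixes f :: "'a::euclidean_space \<Rightarrow> 'b::real_normed_vector"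
  assumes "linear f" "\<And>p. p \<in> T \<Longrightarrow> u p = c + f p" "p \<in> interior T"
  shows "frechet_derivative u (at p) = f"
proof -
  have "((\<lambda>p. c + f p) has_derivative (\<lambda>h. 0 + f h)) (at p)"
    using assms(1)[unfolded linear_conv_bounded_linear]
    by (intro has_derivative_add has_derivative_const bounded_linear_imp_has_derivative)
  then have "((\<lambda>p. c + f p) has_derivative f) (at p)" by simp
  then have "(u has_derivative f) (at p)"
    by (rule has_derivative_transform_within_open[OF _ open_interior assms(3)])
      (metis assms(2) interior_subset subsetD)
  then show ?thesis by (rule frechet_derivative_at[symmetric])
qed

text \<open>
  Cramer's rule for the two linear equations that express the differences of the vertex values
  by the linear part of \<open>u\<close>.
\<close>

lemma frechet_derivative_triangle:
  fixes u :: "real \<times> real \<Rightarrow> complex"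
  assumes D: "orient A B C \<noteq> 0"
    and u: "affine_fun_on (convex hull {A, B, C}) u" and p: "p \<in> interior (convex hull {A, B, C})"
  shows "frechet_derivative u (at p) (1, 0) =
      (of_real (snd B - snd C) * u A + of_real (snd C - snd A) * u B + of_real (snd A - snd B) * u C)
        / of_real (orient A B C)"
    and "frechet_derivative u (at p) (0, 1) =
      (of_real (fst C - fst B) * u A + of_real (fst A - fst C) * u B + of_real (fst B - fst A) * u C)
        / of_real (orient A B C)"
proof -
  let ?T = "convex hull {A, B, C}"
  obtain c f where f: "linear f" and uf: "\<And>p. p \<in> ?T \<Longrightarrow> u p = c + f p"
    using u unfolding affine_fun_on_def by blast
  have F: "frechet_derivative u (at p) = f"
    using f uf p by (rule frechet_derivative_affine_interior)
  have fp: "f q = of_real (fst q) * f (1, 0) + of_real (snd q) * f (0, 1)" for q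
  proof -
    have "q = fst q *\<^sub>R (1, 0) + snd q *\<^sub>R (0, 1)" by (simp add: prod_eq_iff)
    then have "f q = f (fst q *\<^sub>R (1, 0) + snd q *\<^sub>R (0, 1))" by simp
    then show ?thesis by (simp only: linear_add[OF f] linear_cmul[OF f] scaleR_conv_of_real)
  qed
  have "A \<in> ?T" "B \<in> ?T" "C \<in> ?T" by (auto intro: hull_inc)
  then have v: "u A = c + f A" "u B = c + f B" "u C = c + f C" by (auto simp: uf)
  show "frechet_derivative u (at p) (1, 0) =
      (of_real (snd B - snd C) * u A + of_real (snd C - snd A) * u B + of_real (snd A - snd B) * u C)
        / of_real (orient A B C)"
    using D unfolding F v fp[of A] fp[of B] fp[of C]
    by (simp add: eq_divide_eq) (simp add: orient_def algebra_simps)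
  show "frechet_derivative u (at p) (0, 1) =
      (of_real (fst C - fst B) * u A + of_real (fst A - fst C) * u B + of_real (fst B - fst A) * u C)
        / of_real (orient A B C)"
    using D unfolding F v fp[of A] fp[of B] fp[of C]
    by (simp add: eq_divide_eq) (simp add: orient_def algebra_simps)
qed

section \<open>The mesh as a partition of the square\<close>

text \<open>
  The mesh as a list of vertex triples, each listed counterclockwise, so that all orientations are
  positive.
\<close>

definition triangles :: "(node \<times> node \<times> node) list" where
  "triangles = [(G4, G1, O1), (G1, G2, O2), (G2, G3, O3), (G3, G4, O4),
     (G1, O2, O1), (G2, O3, O2), (G3, O4, O3), (G4, O1, O4),
     (O5, O1, O2), (O5, O2, O3), (O5, O3, O4), (O5, O4, O1)]"

fun triangle :: "real \<Rightarrow> node \<times> node \<times> node \<Rightarrow> point set" where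
  "triangle \<alpha> (a, b, c) = convex hull {pos \<alpha> a, pos \<alpha> b, pos \<alpha> c}"

fun double_area :: "real \<Rightarrow> node \<times> node \<times> node \<Rightarrow> real" where
  "double_area \<alpha> (a, b, c) = orient (pos \<alpha> a) (pos \<alpha> b) (pos \<alpha> c)"

lemma mesh_eq: "mesh \<alpha> = triangle \<alpha> ` set triangles"
  by (simp add: mesh_def triangles_def insert_commute)

lemma double_area_values:
  "map (double_area \<alpha>) triangles = replicate 4 (2 * (1 - \<alpha>)) @ replicate 4 (\<alpha> * (2 - \<alpha>)) @ replicate 4 (\<alpha> * \<alpha>)"
  by (simp add: triangles_def orient_def numeral_eq_Suc algebra_simps)

lemma double_area_pos:
  assumes "0 < \<alpha>" "\<alpha> < 1" "t \<in> set triangles"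
  shows "0 < double_area \<alpha> t"
proof -
  have "double_area \<alpha> t \<in> set (map (double_area \<alpha>) triangles)" using assms by simp
  then show ?thesis unfolding double_area_values using assms by auto
qed

lemma closure_dom: "closure dom = {-1..1} \<times> {-1..1}"
  by (simp add: dom_def closure_Times)

lemma pos_in_closure: "0 < \<alpha> \<Longrightarrow> \<alpha> < 1 \<Longrightarrow> pos \<alpha> z \<in> closure dom"
  by (cases z) (auto simp: closure_dom)

lemma triangle_subset:
  assumes "0 < \<alpha>" "\<alpha> < 1"
  shows "triangle \<alpha> t \<subseteq> closure dom"
  using pos_in_closure[OF assms]
  by (cases t) (simp only: triangle.simps, intro hull_minimal,
      auto simp: closure_dom intro!: convex_Times convex_real_interval)

lemma in_triangleI:
  assumes "0 < \<alpha>" "\<alpha> < 1" "(a, b, c) \<in> set triangles"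
    and "orient p (pos \<alpha> b) (pos \<alpha> c) \<ge> 0" "orient (pos \<alpha> a) p (pos \<alpha> c) \<ge> 0"
    "orient (pos \<alpha> a) (pos \<alpha> b) p \<ge> 0"
  shows "\<exists>t\<in>set triangles. p \<in> triangle \<alpha> t"
  using in_convex_hull_3I[of "pos \<alpha> a" "pos \<alpha> b" "pos \<alpha> c" p] double_area_pos[OF assms(1-3)] assms
  by (intro bexI[of _ "(a, b, c)"]) auto

text \<open>
  Each quadrant is covered by four triangles. They are separated by the ring edge, and outside
  of it by the two segments that join the ends of the ring edge to the corner.
\<close>

lemma triangles_cover:
  assumes \<alpha>: "0 < \<alpha>" "\<alpha> < 1" and p: "p \<in> closure dom"
  shows "\<exists>t\<in>set triangles. p \<in> triangle \<alpha> t"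
proof -
  obtain x y where xy: "p = (x, y)" "-1 \<le> x" "x \<le> 1" "-1 \<le> y" "y \<le> 1"
    using p by (cases p) (auto simp: closure_dom)
  note I = in_triangleI[OF \<alpha>, of _ _ _ p]
  \<comment> \<open>The inequalities are linear in \<open>x\<close> and \<open>y\<close> with coefficients that depend on \<open>\<alpha>\<close>. Given these signs,
    linear arithmetic can treat \<open>\<alpha> * x\<close> and \<open>\<alpha> * y\<close> as unknowns.\<close>
  have m: "x \<ge> 0 \<Longrightarrow> \<alpha> * x \<ge> 0" "x \<le> 0 \<Longrightarrow> \<alpha> * x \<le> 0" "y \<ge> 0 \<Longrightarrow> \<alpha> * y \<ge> 0" "y \<le> 0 \<Longrightarrow> \<alpha> * y \<le> 0"
    "x \<ge> 0 \<Longrightarrow> \<alpha> * x \<le> x" "x \<le> 0 \<Longrightarrow> \<alpha> * x \<ge> x" "y \<ge> 0 \<Longrightarrow> \<alpha> * y \<le> y" "y \<le> 0 \<Longrightarrow> \<alpha> * y \<ge> y"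
    using \<alpha> by (auto simp: mult_le_0_iff mult_left_le_one_le mult_le_cancel_right1)
  have sc: "\<alpha> * s \<ge> 0" if "s \<ge> 0" for s using that \<alpha> by simp
  note d = xy(1) triangles_def orient_def algebra_simps
  consider "x \<le> 0" "y \<le> 0" | "x \<ge> 0" "y \<le> 0" | "x \<ge> 0" "y \<ge> 0" | "x \<le> 0" "y \<ge> 0"
    by linarith
  then show ?thesis
  proof cases
    case q: 1
    consider "x + y \<ge> - \<alpha>" | "(1 - \<alpha>) * x - y - \<alpha> \<ge> 0" | "(1 - \<alpha>) * y - x - \<alpha> \<ge> 0"
      | "x + y \<le> - \<alpha>" "(1 - \<alpha>) * x - y - \<alpha> \<le> 0" "(1 - \<alpha>) * y - x - \<alpha> \<le> 0" by linarith
    then show ?thesis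
    proof cases
      case 1 then show ?thesis using q \<alpha> sc[of "x + y + \<alpha>"] sc[of "-x"] sc[of "-y"] by (intro I[of O5 O1 O2]) (auto simp: d)
    next
      case 2 then show ?thesis using q \<alpha> xy m by (intro I[of G1 G2 O2]) (auto simp: d)
    next
      case 3 then show ?thesis using q \<alpha> xy m by (intro I[of G4 G1 O1]) (auto simp: d)
    next
      case 4 then show ?thesis using q \<alpha> sc[of "- x - y - \<alpha>"] by (intro I[of G1 O2 O1]) (auto simp: d)
    qed
  next
    case q: 2
    consider "x - y \<le> \<alpha>" | "(1 - \<alpha>) * - x - y - \<alpha> \<ge> 0" | "(1 - \<alpha>) * y + x - \<alpha> \<ge> 0"
      | "x - y \<ge> \<alpha>" "(1 - \<alpha>) * -x - y - \<alpha> \<le> 0" "(1 - \<alpha>) * y + x - \<alpha> \<le> 0" by linarith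
    then show ?thesis
    proof cases
      case 1 then show ?thesis using q \<alpha> sc[of "y - x + \<alpha>"] sc[of x] sc[of "-y"] by (intro I[of O5 O2 O3]) (auto simp: d)
    next
      case 2 then show ?thesis using q \<alpha> xy m by (intro I[of G1 G2 O2]) (auto simp: d)
    next
      case 3 then show ?thesis using q \<alpha> xy m by (intro I[of G2 G3 O3]) (auto simp: d)
    next
      case 4 then show ?thesis using q \<alpha> sc[of "x - y - \<alpha>"] by (intro I[of G2 O3 O2]) (auto simp: d)
    qed
  next
    case q: 3
    consider "x + y \<le> \<alpha>" | "(1 - \<alpha>) * - x + y - \<alpha> \<ge> 0" | "(1 - \<alpha>) * -y + x - \<alpha> \<ge> 0"
      | "x + y \<ge> \<alpha>" "(1 - \<alpha>) * -x + y - \<alpha> \<le> 0" "(1 - \<alpha>) * -y + x - \<alpha> \<le> 0" by linarith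
    then show ?thesis
    proof cases
      case 1 then show ?thesis using q \<alpha> sc[of "\<alpha> - x - y"] sc[of x] sc[of y] by (intro I[of O5 O3 O4]) (auto simp: d)
    next
      case 2 then show ?thesis using q \<alpha> xy m by (intro I[of G3 G4 O4]) (auto simp: d)
    next
      case 3 then show ?thesis using q \<alpha> xy m by (intro I[of G2 G3 O3]) (auto simp: d)
    next
      case 4 then show ?thesis using q \<alpha> sc[of "x + y - \<alpha>"] by (intro I[of G3 O4 O3]) (auto simp: d)
    qed
  next
    case q: 4
    consider "y - x \<le> \<alpha>" | "(1 - \<alpha>) * x + y - \<alpha> \<ge> 0" | "(1 - \<alpha>) * -y - x - \<alpha> \<ge> 0"
      | "y - x \<ge> \<alpha>" "(1 - \<alpha>) * x + y - \<alpha> \<le> 0" "(1 - \<alpha>) * -y - x - \<alpha> \<le> 0" by linarith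
    then show ?thesis
    proof cases
      case 1 then show ?thesis using q \<alpha> sc[of "\<alpha> + x - y"] sc[of "-x"] sc[of y] by (intro I[of O5 O4 O1]) (auto simp: d)
    next
      case 2 then show ?thesis using q \<alpha> xy m by (intro I[of G3 G4 O4]) (auto simp: d)
    next
      case 3 then show ?thesis using q \<alpha> xy m by (intro I[of G4 G1 O1]) (auto simp: d)
    next
      case 4 then show ?thesis using q \<alpha> sc[of "y - x - \<alpha>"] by (intro I[of G4 O1 O4]) (auto simp: d)
    qed
  qed
qed

lemma has_bochner_integral_on_triangle:
  assumes \<alpha>: "0 < \<alpha>" "\<alpha> < 1" and t: "(a, b, c) \<in> set triangles"
    and u: "u \<in> fe_space \<alpha>" and v: "v \<in> fe_space \<alpha>"
  shows "has_bochner_integral lborel (\<lambda>p. indicator (triangle \<alpha> (a, b, c)) p *\<^sub>R (u p * cnj (v p)))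
    (of_real (double_area \<alpha> (a, b, c)) / 24 *
      ((u (pos \<alpha> a) + u (pos \<alpha> b) + u (pos \<alpha> c)) * cnj (v (pos \<alpha> a) + v (pos \<alpha> b) + v (pos \<alpha> c)) +
       u (pos \<alpha> a) * cnj (v (pos \<alpha> a)) + u (pos \<alpha> b) * cnj (v (pos \<alpha> b)) + u (pos \<alpha> c) * cnj (v (pos \<alpha> c))))"
proof -
  have "affine_fun_on (triangle \<alpha> (a, b, c)) u" "affine_fun_on (triangle \<alpha> (a, b, c)) v"
    using u v t unfolding fe_space_def mesh_eq by blast+
  then show ?thesis
    using has_bochner_integral_triangle[of "pos \<alpha> a" "pos \<alpha> b" "pos \<alpha> c" u v] double_area_pos[OF \<alpha> t] by simp
qed

lemma affine_fun_on_const: "affine_fun_on T (\<lambda>_. c)"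
  unfolding affine_fun_on_def using module_hom_zero by fastforce

text \<open>
  The area of a triangle is the case of two constant functions in the quadrature formula.
\<close>

lemma has_bochner_integral_indicator_triangle:
  assumes \<alpha>: "0 < \<alpha>" "\<alpha> < 1" and t: "t \<in> set triangles"
  shows "has_bochner_integral lborel (indicator (triangle \<alpha> t) :: point \<Rightarrow> real) (double_area \<alpha> t / 2)"
proof -
  obtain a b c where t': "t = (a, b, c)" by (cases t)
  have "has_bochner_integral lborel (\<lambda>p. Re (indicator (triangle \<alpha> t) p *\<^sub>R (1 * cnj 1)))
    (Re (of_real (double_area \<alpha> t) / 24 * ((1 + 1 + 1) * cnj (1 + 1 + 1) + 1 * cnj 1 + 1 * cnj 1 + 1 * cnj 1)))"
    using has_bochner_integral_triangle[OF _ affine_fun_on_const affine_fun_on_const,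
        of "pos \<alpha> a" "pos \<alpha> b" "pos \<alpha> c" 1 1] double_area_pos[OF \<alpha> t]
    by (intro has_bochner_integral_Re) (simp add: t')
  then show ?thesis by (simp add: field_simps)
qed

text \<open>
  No pairwise intersection has to be examined: by the covering, the difference of the two sides is
  nonnegative, and its integral is zero because the areas of the triangles add up to four.
\<close>

lemma AE_indicator_dom_eq_sum_triangles:
  assumes \<alpha>: "0 < \<alpha>" "\<alpha> < 1"
  shows "AE p in lborel. indicator dom p = (\<Sum>t\<leftarrow>triangles. indicator (triangle \<alpha> t) p :: real)"
proof -
  let ?h = "\<lambda>p. (\<Sum>t\<in>set triangles. indicator (triangle \<alpha> t) p :: real) - indicator dom p"
  have dist: "distinct triangles" by (simp add: triangles_def)
  have sum: "sum f (set triangles) = (\<Sum>t\<leftarrow>triangles. f t)" for f :: "_ \<Rightarrow> real"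
    using dist by (simp add: sum_list_distinct_conv_sum_set)
  have dom: "has_bochner_integral lborel (indicator dom :: point \<Rightarrow> real) 4"
  proof -
    have box: "dom = box (-1, -1) (1, 1)" by (auto simp: dom_def box_def Basis_prod_def)
    have "emeasure lborel dom = ennreal 4"
      unfolding box by (subst emeasure_lborel_box) (auto simp: Basis_prod_def)
    moreover have "dom \<in> sets lborel" unfolding box by simp
    ultimately have "has_bochner_integral lborel (indicator dom :: point \<Rightarrow> real) (measure lborel dom)"
      by (intro has_bochner_integral_real_indicator) auto
    moreover have "measure lborel dom = 4" using \<open>emeasure lborel dom = ennreal 4\<close> by (simp add: measure_def)
    ultimately show ?thesis by simp
  qed
  have "has_bochner_integral lborel ?h ((\<Sum>t\<in>set triangles. double_area \<alpha> t / 2) - 4)"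
    by (intro has_bochner_integral_diff has_bochner_integral_sum dom
        has_bochner_integral_indicator_triangle \<alpha>)
  moreover have "(\<Sum>t\<in>set triangles. double_area \<alpha> t / 2) = 4"
    unfolding sum by (simp add: triangles_def orient_def field_simps)
  ultimately have h: "integrable lborel ?h" "integral\<^sup>L lborel ?h = 0"
    by (auto simp: has_bochner_integral_iff)
  have nonneg: "0 \<le> ?h p" for p
  proof (cases "p \<in> dom")
    case True
    then have "p \<in> closure dom" using closure_subset by blast
    then obtain t where t: "t \<in> set triangles" "p \<in> triangle \<alpha> t" using triangles_cover[OF \<alpha>] by blast
    have "(indicator (triangle \<alpha> t) p :: real) \<le> (\<Sum>t\<in>set triangles. indicator (triangle \<alpha> t) p)"
      by (rule member_le_sum) (use t in auto)
    with t True show ?thesis by simp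
  qed (simp add: sum_nonneg)
  have "AE p in lborel. ?h p = 0"
    using h nonneg by (subst integral_nonneg_eq_0_iff_AE[symmetric]) auto
  then show ?thesis unfolding sum by eventually_elim simp
qed

section \<open>The form in terms of nodal values\<close>

fun local_mass :: "real \<Rightarrow> (node \<Rightarrow> complex) \<Rightarrow> (node \<Rightarrow> complex) \<Rightarrow> node \<times> node \<times> node \<Rightarrow> complex" where
  "local_mass \<alpha> x y (a, b, c) = of_real (double_area \<alpha> (a, b, c)) / 24 *
     ((x a + x b + x c) * cnj (y a + y b + y c) + x a * cnj (y a) + x b * cnj (y b) + x c * cnj (y c))"

lemma has_bochner_integral_sum_list:
  assumes "\<And>t. t \<in> set ts \<Longrightarrow> has_bochner_integral M (f t) (I t)"
  shows "has_bochner_integral M (\<lambda>p. \<Sum>t\<leftarrow>ts. f t p) (\<Sum>t\<leftarrow>ts. I t)"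
  using assms by (induction ts) (auto intro: has_bochner_integral_zero has_bochner_integral_add)

lemma scaleR_sum_list:
  fixes z :: "'a::real_vector"
  shows "(\<Sum>t\<leftarrow>ts. f t) *\<^sub>R z = (\<Sum>t\<leftarrow>ts. f t *\<^sub>R z)"
  by (induction ts) (auto simp: scaleR_add_left)

text \<open>
  Integrals over the square reduce to integrals over the triangles. The integrand is only required to
  agree almost everywhere on each triangle with an integrable function, since the gradient is not
  controlled on the edges; completeness of the Lebesgue measure supplies its measurability.
\<close>

lemma set_lebesgue_integral_dom:
  fixes g :: "point \<Rightarrow> complex"
  assumes \<alpha>: "0 < \<alpha>" "\<alpha> < 1"
    and g: "\<And>t. t \<in> set triangles \<Longrightarrow> \<exists>g'. has_bochner_integral lborel g' (I t) \<and>
      (AE p in lborel. indicator (triangle \<alpha> t) p *\<^sub>R g p = g' p)"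
  shows "(LINT p:dom|lebesgue. g p) = (\<Sum>t\<leftarrow>triangles. I t)"
proof -
  obtain g' where g': "\<And>t. t \<in> set triangles \<Longrightarrow> has_bochner_integral lborel (g' t) (I t)"
    and ae: "\<And>t. t \<in> set triangles \<Longrightarrow> AE p in lborel. indicator (triangle \<alpha> t) p *\<^sub>R g p = g' t p"
    using g by metis
  have G: "has_bochner_integral lborel (\<lambda>p. \<Sum>t\<leftarrow>triangles. g' t p) (\<Sum>t\<leftarrow>triangles. I t)"
    by (intro has_bochner_integral_sum_list g')
  have "AE p in lborel. \<forall>t\<in>set triangles. indicator (triangle \<alpha> t) p *\<^sub>R g p = g' t p"
    using ae by (intro AE_finite_allI) auto
  with AE_indicator_dom_eq_sum_triangles[OF \<alpha>]
  have "AE p in lborel. indicator dom p *\<^sub>R g p = (\<Sum>t\<leftarrow>triangles. g' t p)"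
  proof eventually_elim
    case (elim p)
    have "indicator dom p *\<^sub>R g p = (\<Sum>t\<leftarrow>triangles. indicator (triangle \<alpha> t) p *\<^sub>R g p)"
      unfolding elim(1) using scaleR_sum_list[of "\<lambda>t. indicator (triangle \<alpha> t) p" triangles "g p"] by simp
    also have "\<dots> = (\<Sum>t\<leftarrow>triangles. g' t p)"
      using elim(2) by (intro arg_cong[of _ _ sum_list] map_cong) auto
    finally show ?case .
  qed
  then have ae': "AE p in lebesgue. indicator dom p *\<^sub>R g p = (\<Sum>t\<leftarrow>triangles. g' t p)"
    by (rule AE_completion)
  have m: "(\<lambda>p. \<Sum>t\<leftarrow>triangles. g' t p) \<in> borel_measurable lborel"
    using G unfolding has_bochner_integral_iff by (intro borel_measurable_integrable) simp
  have "(LINT p:dom|lebesgue. g p) = integral\<^sup>L lebesgue (\<lambda>p. \<Sum>t\<leftarrow>triangles. g' t p)"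
    unfolding set_lebesgue_integral_def
  proof (rule integral_cong_AE[OF _ _ ae'])
    show ml: "(\<lambda>p. \<Sum>t\<leftarrow>triangles. g' t p) \<in> borel_measurable lebesgue"
      using m by (rule measurable_completion)
    show "(\<lambda>p. indicator dom p *\<^sub>R g p) \<in> borel_measurable lebesgue"
      by (rule borel_measurable_AE[OF ml]) (use ae' in eventually_elim, simp)
  qed
  also have "\<dots> = (\<Sum>t\<leftarrow>triangles. I t)"
    using G m by (simp add: integral_completion has_bochner_integral_iff)
  finally show ?thesis .
qed

lemma L2_inner_eq:
  assumes \<alpha>: "0 < \<alpha>" "\<alpha> < 1" and u: "u \<in> fe_space \<alpha>" and v: "v \<in> fe_space \<alpha>"
  shows "L2_inner u v = (\<Sum>t\<leftarrow>triangles. local_mass \<alpha> (u \<circ> pos \<alpha>) (v \<circ> pos \<alpha>) t)"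
  unfolding L2_inner_def
proof (rule set_lebesgue_integral_dom[OF \<alpha>])
  fix t assume t: "t \<in> set triangles"
  obtain a b c where t': "t = (a, b, c)" by (cases t)
  have "has_bochner_integral lborel (\<lambda>p. indicator (triangle \<alpha> t) p *\<^sub>R (u p * cnj (v p)))
      (local_mass \<alpha> (u \<circ> pos \<alpha>) (v \<circ> pos \<alpha>) t)"
    using has_bochner_integral_on_triangle[OF \<alpha> t[unfolded t'] u v] by (simp add: t')
  then show "\<exists>g'. has_bochner_integral lborel g' (local_mass \<alpha> (u \<circ> pos \<alpha>) (v \<circ> pos \<alpha>) t) \<and>
    (AE p in lborel. indicator (triangle \<alpha> t) p *\<^sub>R (u p * cnj (v p)) = g' p)" by auto
qed

text \<open>
  The two components of the gradient on a triangle, multiplied by \<open>double_area\<close>.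
\<close>

definition grad_x :: "real \<Rightarrow> (node \<Rightarrow> complex) \<Rightarrow> node \<times> node \<times> node \<Rightarrow> complex" where
  "grad_x \<alpha> x = (\<lambda>(a, b, c). of_real (snd (pos \<alpha> b) - snd (pos \<alpha> c)) * x a +
     of_real (snd (pos \<alpha> c) - snd (pos \<alpha> a)) * x b + of_real (snd (pos \<alpha> a) - snd (pos \<alpha> b)) * x c)"

definition grad_y :: "real \<Rightarrow> (node \<Rightarrow> complex) \<Rightarrow> node \<times> node \<times> node \<Rightarrow> complex" where
  "grad_y \<alpha> x = (\<lambda>(a, b, c). of_real (fst (pos \<alpha> c) - fst (pos \<alpha> b)) * x a +
     of_real (fst (pos \<alpha> a) - fst (pos \<alpha> c)) * x b + of_real (fst (pos \<alpha> b) - fst (pos \<alpha> a)) * x c)"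

definition local_stiffness :: "real \<Rightarrow> (node \<Rightarrow> complex) \<Rightarrow> (node \<Rightarrow> complex) \<Rightarrow> node \<times> node \<times> node \<Rightarrow> complex" where
  "local_stiffness \<alpha> x y t = (grad_x \<alpha> x t * cnj (grad_x \<alpha> y t) + grad_y \<alpha> x t * cnj (grad_y \<alpha> y t)) /
     of_real (2 * double_area \<alpha> t)"

text \<open>
  The gradient is constant in the interior of each triangle, and the frontier of a convex set is
  negligible.
\<close>

lemma grad_inner_eq:
  assumes \<alpha>: "0 < \<alpha>" "\<alpha> < 1" and u: "u \<in> fe_space \<alpha>" and v: "v \<in> fe_space \<alpha>"
  shows "grad_inner u v = (\<Sum>t\<leftarrow>triangles. local_stiffness \<alpha> (u \<circ> pos \<alpha>) (v \<circ> pos \<alpha>) t)"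
  unfolding grad_inner_def
proof (rule set_lebesgue_integral_dom[OF \<alpha>])
  fix t assume t: "t \<in> set triangles"
  obtain a b c where t': "t = (a, b, c)" by (cases t)
  let ?g = "\<lambda>p. \<Sum>e\<in>Basis. frechet_derivative u (at p) e * cnj (frechet_derivative v (at p) e)"
  let ?x = "u \<circ> pos \<alpha>" and ?y = "v \<circ> pos \<alpha>"
  let ?G = "(grad_x \<alpha> ?x t * cnj (grad_x \<alpha> ?y t) + grad_y \<alpha> ?x t * cnj (grad_y \<alpha> ?y t)) /
     of_real ((double_area \<alpha> t)\<^sup>2)"
  have D: "double_area \<alpha> t > 0" by (rule double_area_pos[OF \<alpha> t])
  have aff: "affine_fun_on (triangle \<alpha> t) u" "affine_fun_on (triangle \<alpha> t) v"
    using u v t unfolding fe_space_def mesh_eq by blast+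
  have "has_bochner_integral lborel (\<lambda>p. indicator (triangle \<alpha> t) p *\<^sub>R ?G) ((double_area \<alpha> t / 2) *\<^sub>R ?G)"
    by (intro has_bochner_integral_scaleR_left has_bochner_integral_indicator_triangle \<alpha> t)
  moreover have "(double_area \<alpha> t / 2) *\<^sub>R ?G = local_stiffness \<alpha> ?x ?y t"
    using D by (simp add: local_stiffness_def scaleR_conv_of_real field_simps power2_eq_square)
  moreover have "AE p in lborel. indicator (triangle \<alpha> t) p *\<^sub>R ?g p = indicator (triangle \<alpha> t) p *\<^sub>R ?G"
  proof -
    have "convex (triangle \<alpha> t)" by (cases t) (simp add: convex_convex_hull)
    then have "negligible (frontier (triangle \<alpha> t))" by (rule negligible_convex_frontier)
    then have "AE p in lebesgue. p \<notin> frontier (triangle \<alpha> t)"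
      by (metis AE_not_in negligible_iff_null_sets)
    then have "AE p in lborel. p \<notin> frontier (triangle \<alpha> t)"
      by (simp add: AE_completion_iff)
    then show ?thesis
    proof eventually_elim
      case (elim p)
      show ?case
      proof (cases "p \<in> triangle \<alpha> t")
        case True
        then have "p \<in> closure (triangle \<alpha> t)" using closure_subset by blast
        with elim have p: "p \<in> interior (triangle \<alpha> t)" by (simp add: frontier_def)
        have "?g p = frechet_derivative u (at p) (1, 0) * cnj (frechet_derivative v (at p) (1, 0)) +
           frechet_derivative u (at p) (0, 1) * cnj (frechet_derivative v (at p) (0, 1))"
          by (simp add: Basis_prod_def)
        also have "\<dots> = ?G"
        proof -
          have "frechet_derivative w (at p) (1, 0) = grad_x \<alpha> (w \<circ> pos \<alpha>) t / of_real (double_area \<alpha> t)"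
            "frechet_derivative w (at p) (0, 1) = grad_y \<alpha> (w \<circ> pos \<alpha>) t / of_real (double_area \<alpha> t)"
            if "affine_fun_on (triangle \<alpha> t) w" for w
            using frechet_derivative_triangle[of "pos \<alpha> a" "pos \<alpha> b" "pos \<alpha> c" w p] D that p
            by (simp_all add: t' grad_x_def grad_y_def)
          then show ?thesis using aff by (simp add: add_divide_distrib power2_eq_square)
        qed
        finally show ?thesis by simp
      qed simp
    qed
  qed
  ultimately show "\<exists>g'. has_bochner_integral lborel g' (local_stiffness \<alpha> ?x ?y t) \<and>
    (AE p in lborel. indicator (triangle \<alpha> t) p *\<^sub>R ?g p = g' p)" by auto
qed

lemma set_integral_affine_product:
  fixes a b c d :: complex
  shows "(LINT t:{-1..1}|lebesgue. (a + of_real t * b) * (c + of_real t * d)) = 2 * a * c + 2 / 3 * b * d"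
proof -
  let ?g = "\<lambda>t :: real. (a + of_real t * b) * (c + of_real t * d)"
  let ?F = "\<lambda>z. a * c * z + (a * d + b * c) * z ^ 2 / 2 + b * d * z ^ 3 / 3"
  have "(?g has_integral (?F (of_real 1) - ?F (of_real (-1)))) {-1..1}"
  proof (rule fundamental_theorem_of_calculus)
    fix t :: real assume "t \<in> {-1..1}"
    have "(?F has_field_derivative ?g t) (at (of_real t))"
      by (auto intro!: derivative_eq_intros simp: field_simps power2_eq_square)
    then show "((\<lambda>t. ?F (of_real t)) has_vector_derivative ?g t) (at t within {-1..1})"
      by (rule has_vector_derivative_real_field)
  qed simp
  then have "integral {-1..1} ?g = 2 * a * c + 2 / 3 * b * d"
    by (simp add: integral_unique field_simps)
  moreover have "set_integrable lebesgue {-1..1} ?g"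
    by (intro absolutely_integrable_continuous_real continuous_intros)
  ultimately show ?thesis by (simp add: set_lebesgue_integral_eq_integral)
qed

text \<open>
  The mass matrix of a segment of length two, the length of a side of the square.
\<close>

lemma set_integral_side:
  fixes u v :: "point \<Rightarrow> complex"
  assumes u: "affine_fun_on T u" and v: "affine_fun_on T v" and T: "convex T" "P \<in> T" "Q \<in> T"
    and p: "\<And>t. p t = P + ((t + 1) / 2) *\<^sub>R (Q - P)"
  shows "(LINT t:{-1..1}|lebesgue. u (p t) * cnj (v (p t))) =
    ((u P + u Q) * cnj (v P + v Q) + u P * cnj (v P) + u Q * cnj (v Q)) / 3"
proof -
  have val: "w (p t) = (w P + w Q) / 2 + of_real t * ((w Q - w P) / 2)"
    if "affine_fun_on T w" "t \<in> {-1..1}" for w t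
  proof -
    have "P + ((t + 1) / 2) *\<^sub>R (Q - P) \<in> T"
    proof -
      have "(1 - (t + 1) / 2) *\<^sub>R P + ((t + 1) / 2) *\<^sub>R Q \<in> T"
        using T that by (intro convexD) (auto simp: field_simps)
      also have "(1 - (t + 1) / 2) *\<^sub>R P + ((t + 1) / 2) *\<^sub>R Q = P + ((t + 1) / 2) *\<^sub>R (Q - P)"
        by (simp only: scaleR_diff_left scaleR_diff_right scaleR_one) simp
      finally show ?thesis .
    qed
    then have e: "w (p t) = w P + of_real ((t + 1) / 2) * (w Q - w P)"
      using affine_fun_on_param[OF that(1) T(2,3,3), of "(t + 1) / 2" 0] by (simp add: p)
    show ?thesis unfolding e by (simp add: field_simps)
  qed
  have "(LINT t:{-1..1}|lebesgue. u (p t) * cnj (v (p t))) =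
    (LINT t:{-1..1}|lebesgue. ((u P + u Q) / 2 + of_real t * ((u Q - u P) / 2)) *
       (cnj ((v P + v Q) / 2) + of_real t * cnj ((v Q - v P) / 2)))"
    unfolding set_lebesgue_integral_def
    by (intro Bochner_Integration.integral_cong refl) (auto simp: indicator_def val[OF u] val[OF v])
  also have "\<dots> = ((u P + u Q) * cnj (v P + v Q) + u P * cnj (v P) + u Q * cnj (v Q)) / 3"
    unfolding set_integral_affine_product by (simp add: field_simps)
  finally show ?thesis .
qed

text \<open>
  The boundary sides are traversed counterclockwise here. The arc length parametrisations of the top and
  left sides run the other way; the local form is symmetric in the two end points.
\<close>

definition sides :: "(node \<times> node) list" where
  "sides = [(G1, G2), (G2, G3), (G3, G4), (G4, G1)]"

fun local_boundary :: "(node \<Rightarrow> complex) \<Rightarrow> (node \<Rightarrow> complex) \<Rightarrow> node \<times> node \<Rightarrow> complex" where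
  "local_boundary x y (a, b) = ((x a + x b) * cnj (y a + y b) + x a * cnj (y a) + x b * cnj (y b)) / 3"

lemma boundary_inner_eq:
  assumes u: "u \<in> fe_space \<alpha>" and v: "v \<in> fe_space \<alpha>"
  shows "boundary_inner u v = (\<Sum>e\<leftarrow>sides. local_boundary (u \<circ> pos \<alpha>) (v \<circ> pos \<alpha>) e)"
proof -
  have side: "(LINT t:{-1..1}|lebesgue. u (p t) * cnj (v (p t))) =
     local_boundary (u \<circ> pos \<alpha>) (v \<circ> pos \<alpha>) (a, b)"
    if t: "(a, b, c) \<in> set triangles \<or> (b, a, c) \<in> set triangles"
      and p: "\<And>t. p t = pos \<alpha> a + ((t + 1) / 2) *\<^sub>R (pos \<alpha> b - pos \<alpha> a)" for a b c p
  proof -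
    let ?T = "convex hull {pos \<alpha> a, pos \<alpha> b, pos \<alpha> c}"
    have "?T \<in> mesh \<alpha>" using t unfolding mesh_eq by (force simp: insert_commute)
    then have "affine_fun_on ?T u" "affine_fun_on ?T v"
      using u v unfolding fe_space_def by auto
    from set_integral_side[OF this _ _ _ p]
    show ?thesis by (simp add: convex_convex_hull hull_inc)
  qed
  let ?L = "local_boundary (u \<circ> pos \<alpha>) (v \<circ> pos \<alpha>)"
  have "(LINT t:{-1..1}|lebesgue. u (t, -1) * cnj (v (t, -1))) = ?L (G1, G2)"
    by (rule side[of G1 G2 O2]) (auto simp: triangles_def field_simps)
  moreover have "(LINT t:{-1..1}|lebesgue. u (1, t) * cnj (v (1, t))) = ?L (G2, G3)"
    by (rule side[of G2 G3 O3]) (auto simp: triangles_def field_simps)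
  moreover have "(LINT t:{-1..1}|lebesgue. u (t, 1) * cnj (v (t, 1))) = ?L (G4, G3)"
    by (rule side[of G4 G3 O4]) (auto simp: triangles_def field_simps)
  moreover have "(LINT t:{-1..1}|lebesgue. u (-1, t) * cnj (v (-1, t))) = ?L (G1, G4)"
    by (rule side[of G1 G4 O1]) (auto simp: triangles_def field_simps)
  ultimately have "boundary_inner u v = ?L (G1, G2) + ?L (G2, G3) + ?L (G4, G3) + ?L (G1, G4)"
    unfolding boundary_inner_def boundary_integral_def by presburger
  then show ?thesis by (simp add: sides_def algebra_simps)
qed

definition discrete_form :: "real \<Rightarrow> real \<Rightarrow> (node \<Rightarrow> complex) \<Rightarrow> (node \<Rightarrow> complex) \<Rightarrow> complex" where
  "discrete_form \<alpha> k x y = (\<Sum>t\<leftarrow>triangles. local_stiffness \<alpha> x y t)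
     - (of_real k)\<^sup>2 * (\<Sum>t\<leftarrow>triangles. local_mass \<alpha> x y t)
     - \<i> * of_real k * (\<Sum>e\<leftarrow>sides. local_boundary x y e)"

lemma helmholtz_form_eq:
  assumes "0 < \<alpha>" "\<alpha> < 1" "u \<in> fe_space \<alpha>" "v \<in> fe_space \<alpha>"
  shows "helmholtz_form k u v = discrete_form \<alpha> k (u \<circ> pos \<alpha>) (v \<circ> pos \<alpha>)"
  using assms by (simp add: helmholtz_form_def discrete_form_def L2_inner_eq grad_inner_eq boundary_inner_eq)

section \<open>The nodal basis\<close>

lemma fe_space_affine: "u \<in> fe_space \<alpha> \<Longrightarrow> t \<in> set triangles \<Longrightarrow> affine_fun_on (triangle \<alpha> t) u"
  by (auto simp: fe_space_def mesh_eq)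

lemma fe_space_eqI:
  assumes \<alpha>: "0 < \<alpha>" "\<alpha> < 1" and u: "u \<in> fe_space \<alpha>" and v: "v \<in> fe_space \<alpha>"
    and nodes: "\<And>z. u (pos \<alpha> z) = v (pos \<alpha> z)"
  shows "u = v"
proof
  fix p show "u p = v p"
  proof (cases "p \<in> closure dom")
    case True
    then obtain a b c where t: "(a, b, c) \<in> set triangles" and p: "p \<in> triangle \<alpha> (a, b, c)"
      using triangles_cover[OF \<alpha>] by (metis prod_cases3)
    from p obtain s r where sr: "p = pos \<alpha> a + s *\<^sub>R (pos \<alpha> b - pos \<alpha> a) + r *\<^sub>R (pos \<alpha> c - pos \<alpha> a)"
      by (auto simp: convex_hull_3_param)
    have w: "w p = w (pos \<alpha> a) + of_real s * (w (pos \<alpha> b) - w (pos \<alpha> a)) + of_real r * (w (pos \<alpha> c) - w (pos \<alpha> a))"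
      if "w \<in> fe_space \<alpha>" for w
      using affine_fun_on_param[OF fe_space_affine[OF that t]] p unfolding sr by (simp add: hull_inc)
    show ?thesis unfolding w[OF u] w[OF v] nodes ..
  next
    case False
    with u v show ?thesis by (simp add: fe_space_def del: split_paired_All)
  qed
qed

lemma affine_fun_on_add:
  assumes "affine_fun_on T u" "affine_fun_on T v"
  shows "affine_fun_on T (\<lambda>p. u p + v p)"
proof -
  obtain c f d g where "linear f" "linear g" "\<forall>p\<in>T. u p = c + f p" "\<forall>p\<in>T. v p = d + g p"
    using assms unfolding affine_fun_on_def by blast
  then show ?thesis unfolding affine_fun_on_def
    by (intro exI[of _ "c + d"] exI[of _ "\<lambda>p. f p + g p"]) (auto intro: linear_compose_add)
qed

lemma affine_fun_on_mult:
  assumes "affine_fun_on T u"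
  shows "affine_fun_on T (\<lambda>p. a * u p)"
proof -
  obtain c f where f: "linear f" "\<forall>p\<in>T. u p = c + f p"
    using assms unfolding affine_fun_on_def by blast
  have "linear (\<lambda>p. a * f p)"
    using linear_compose[OF f(1) bounded_linear.linear[OF bounded_linear_mult_right[of a]]] by (simp add: o_def)
  with f show ?thesis unfolding affine_fun_on_def
    by (intro exI[of _ "a * c"] exI[of _ "\<lambda>p. a * f p"]) (auto simp: algebra_simps)
qed

lemma fe_space_add: "u \<in> fe_space \<alpha> \<Longrightarrow> v \<in> fe_space \<alpha> \<Longrightarrow> (\<lambda>p. u p + v p) \<in> fe_space \<alpha>"
  by (auto simp: fe_space_def intro: continuous_intros affine_fun_on_add)

lemma fe_space_mult: "u \<in> fe_space \<alpha> \<Longrightarrow> (\<lambda>p. a * u p) \<in> fe_space \<alpha>"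
  by (auto simp: fe_space_def intro: continuous_intros affine_fun_on_mult)

lemma fe_space_zero: "(\<lambda>p. 0) \<in> fe_space \<alpha>"
  by (auto simp: fe_space_def intro: continuous_intros affine_fun_on_const)

lemma fe_space_sum:
  "finite A \<Longrightarrow> (\<And>i. i \<in> A \<Longrightarrow> u i \<in> fe_space \<alpha>) \<Longrightarrow> (\<lambda>p. \<Sum>i\<in>A. u i p) \<in> fe_space \<alpha>"
  by (induction A rule: finite_induct) (auto intro: fe_space_zero fe_space_add)

text \<open>
  The way in which elements of the space are produced: from a continuous real function on the
  plane that is affine on each triangle, restricted to the closed square.
\<close>

lemma fe_space_piecewise:
  fixes h :: "point \<Rightarrow> real"
  assumes h: "continuous_on UNIV h"
    and pw: "\<And>t. t \<in> set triangles \<Longrightarrow> affine_fun_on (triangle \<alpha> t) (\<lambda>p. of_real (h p))"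
    and \<alpha>: "0 < \<alpha>" "\<alpha> < 1"
  shows "(\<lambda>p. if p \<in> closure dom then of_real (h p) else 0) \<in> fe_space \<alpha>" (is "?u \<in> _")
proof -
  have "continuous_on (closure dom) (\<lambda>p. complex_of_real (h p))"
    by (intro continuous_intros continuous_on_subset[OF h]) auto
  then have "continuous_on (closure dom) ?u" by (rule continuous_on_eq) auto
  moreover have "affine_fun_on (triangle \<alpha> t) ?u" if "t \<in> set triangles" for t
    using pw[OF that] triangle_subset[OF \<alpha>, of t] unfolding affine_fun_on_def by (metis (no_types, lifting) subsetD)
  ultimately show ?thesis by (auto simp: fe_space_def mesh_eq)
qed

definition real_affine :: "(point \<Rightarrow> real) \<Rightarrow> bool" where
  "real_affine f \<longleftrightarrow> (\<exists>a b c. f = (\<lambda>p. a + b * fst p + c * snd p))"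

lemma real_affineI: "real_affine (\<lambda>p. (a + b * fst p + c * snd p) / d)"
  unfolding real_affine_def
  by (intro exI[of _ "a / d"] exI[of _ "b / d"] exI[of _ "c / d"]) (simp add: add_divide_distrib)

lemma affine_fun_on_real_affine:
  assumes "real_affine f" "\<And>p. p \<in> T \<Longrightarrow> h p = f p"
  shows "affine_fun_on T (\<lambda>p. of_real (h p))"
proof -
  obtain a b c where f: "f = (\<lambda>p. a + b * fst p + c * snd p)"
    using assms(1) unfolding real_affine_def by blast
  have "linear (\<lambda>p. complex_of_real (b * fst p + c * snd p))"
    by (rule linearI) (auto simp: algebra_simps scaleR_conv_of_real)
  then show ?thesis
    using assms(2) unfolding affine_fun_on_def f
    by (intro exI[of _ "of_real a"] exI[of _ "\<lambda>p. of_real (b * fst p + c * snd p)"]) simp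
qed

lemma continuous_real_affine: "real_affine f \<Longrightarrow> continuous_on S f"
  unfolding real_affine_def by (auto intro!: continuous_intros)

text \<open>
  Comparing affine functions on a triangle only takes a comparison at the vertices. This identifies the
  maximum or minimum of several affine functions on each triangle.
\<close>

lemma real_affine_le_triangle:
  assumes f: "real_affine f" and g: "real_affine g" and p: "p \<in> triangle \<alpha> (i, j, k)"
    and v: "f (pos \<alpha> i) \<le> g (pos \<alpha> i)" "f (pos \<alpha> j) \<le> g (pos \<alpha> j)" "f (pos \<alpha> k) \<le> g (pos \<alpha> k)"
  shows "f p \<le> g p"
proof -
  obtain a b c a' b' c' where fg: "f = (\<lambda>p. a + b * fst p + c * snd p)" "g = (\<lambda>p. a' + b' * fst p + c' * snd p)"
    using f g unfolding real_affine_def by blast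
  let ?H = "{p. (b - b', c - c') \<bullet> p \<le> a' - a}"
  have H: "p \<in> ?H \<longleftrightarrow> f p \<le> g p" for p
    by (auto simp: fg inner_prod_def algebra_simps)
  have "triangle \<alpha> (i, j, k) \<subseteq> ?H"
    unfolding triangle.simps
  proof (rule hull_minimal)
    show "{pos \<alpha> i, pos \<alpha> j, pos \<alpha> k} \<subseteq> ?H" using v H by blast
  qed (rule convex_halfspace_le)
  with p H show ?thesis by blast
qed

definition has_nodal_function :: "real \<Rightarrow> node \<Rightarrow> bool" where
  "has_nodal_function \<alpha> z \<longleftrightarrow> (\<exists>b\<in>fe_space \<alpha>. \<forall>y. b (pos \<alpha> y) = (if y = z then 1 else 0))"

lemma has_nodal_functionI:
  assumes "continuous_on UNIV h" "0 < \<alpha>" "\<alpha> < 1"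
    and "\<And>t. t \<in> set triangles \<Longrightarrow> affine_fun_on (triangle \<alpha> t) (\<lambda>p. of_real (h p))"
    and "\<And>y. h (pos \<alpha> y) = (if y = z then 1 else 0)"
  shows "has_nodal_function \<alpha> z"
  unfolding has_nodal_function_def
proof (rule bexI)
  show "(\<lambda>p. if p \<in> closure dom then of_real (h p) else 0) \<in> fe_space \<alpha>"
    by (rule fe_space_piecewise) (use assms in auto)
  show "\<forall>y. (if pos \<alpha> y \<in> closure dom then complex_of_real (h (pos \<alpha> y)) else 0) = (if y = z then 1 else 0)"
    using assms(5) pos_in_closure[OF assms(2,3)] by simp
qed

text \<open>
  The hat function of a corner is the maximum of zero and the affine functions \<open>l\<close>, \<open>m\<close>, \<open>r\<close>
  that it equals on the three triangles at the corner: its graph over these triangles is convex, and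
  the three functions are nonpositive at all other nodes.
\<close>

lemma has_nodal_function_G1:
  assumes \<alpha>: "0 < \<alpha>" "\<alpha> < 1"
  shows "has_nodal_function \<alpha> G1"
proof -
  define l where "l = (\<lambda>p :: point. (- \<alpha> + (-1) * fst p + (\<alpha> - 1) * snd p) / (2 * (1 - \<alpha>)))"
  define m where "m = (\<lambda>p :: point. (- \<alpha> + (-1) * fst p + (-1) * snd p) / (2 - \<alpha>))"
  define r where "r = (\<lambda>p :: point. (- \<alpha> + (\<alpha> - 1) * fst p + (-1) * snd p) / (2 * (1 - \<alpha>)))"
  define zero where "zero = (\<lambda>p :: point. (0 + 0 * fst p + 0 * snd p) / 1 :: real)"
  have aff: "real_affine l" "real_affine m" "real_affine r" "real_affine zero"
    unfolding l_def m_def r_def zero_def by (rule real_affineI)+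
  define h where "h = (\<lambda>p. max (max (l p) (r p)) (max (m p) (zero p)))"
  have one: "l (pos \<alpha> G1) = 1" "m (pos \<alpha> G1) = 1" "r (pos \<alpha> G1) = 1" "\<And>z. zero (pos \<alpha> z) = 0"
    "l (pos \<alpha> G4) = 0" "l (pos \<alpha> O1) = 0" "r (pos \<alpha> G2) = 0" "r (pos \<alpha> O2) = 0"
    "m (pos \<alpha> O1) = 0" "m (pos \<alpha> O2) = 0"
    using \<alpha> by (simp_all add: l_def m_def r_def zero_def divide_eq_eq) (simp_all add: algebra_simps)?
  have aa: "\<alpha> * \<alpha> \<ge> 0" "\<alpha> * \<alpha> \<le> \<alpha>" using \<alpha> by (auto simp: mult_left_le)
  have le: "l (pos \<alpha> z) \<le> 0" "m (pos \<alpha> z) \<le> 0" "r (pos \<alpha> z) \<le> 0" if "z \<noteq> G1" for z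
    using that \<alpha> aa by (cases z; simp add: l_def m_def r_def divide_le_0_iff algebra_simps)+
  show ?thesis
  proof (rule has_nodal_functionI[OF _ \<alpha>])
    show "continuous_on UNIV h" unfolding h_def by (intro continuous_intros continuous_real_affine aff)
    show "h (pos \<alpha> y) = (if y = G1 then 1 else 0)" for y
      using le[of y] by (cases "y = G1") (auto simp: h_def one max_def simp del: pos.simps)
    fix t assume t: "t \<in> set triangles"
    obtain i j k where t': "t = (i, j, k)" by (cases t)
    note le_on = real_affine_le_triangle[where i = i and j = j and k = k and \<alpha> = \<alpha>, folded t', rotated 2]
    consider "t = (G4, G1, O1)" | "t = (G1, G2, O2)" | "t = (G1, O2, O1)" | "G1 \<notin> {i, j, k}"
      using t unfolding triangles_def t' by auto
    then show "affine_fun_on (triangle \<alpha> t) (\<lambda>p. of_real (h p))"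
    proof cases
      case 1
      have "h p = l p" if "p \<in> triangle \<alpha> t" for p
      proof -
        have "m p \<le> l p" "r p \<le> l p" "zero p \<le> l p"
          by (rule le_on[OF that]; use 1 in \<open>auto simp: aff t' le one simp del: pos.simps\<close>)+
        then show ?thesis by (simp add: h_def max_def)
      qed
      with aff(1) show ?thesis by (rule affine_fun_on_real_affine)
    next
      case 2
      have "h p = r p" if "p \<in> triangle \<alpha> t" for p
      proof -
        have "m p \<le> r p" "l p \<le> r p" "zero p \<le> r p"
          by (rule le_on[OF that]; use 2 in \<open>auto simp: aff t' le one simp del: pos.simps\<close>)+
        then show ?thesis by (simp add: h_def max_def)
      qed
      with aff(3) show ?thesis by (rule affine_fun_on_real_affine)
    next
      case 3
      have "h p = m p" if "p \<in> triangle \<alpha> t" for p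
      proof -
        have "l p \<le> m p" "r p \<le> m p" "zero p \<le> m p"
          by (rule le_on[OF that]; use 3 in \<open>auto simp: aff t' le one simp del: pos.simps\<close>)+
        then show ?thesis by (simp add: h_def max_def)
      qed
      with aff(2) show ?thesis by (rule affine_fun_on_real_affine)
    next
      case 4
      have "h p = zero p" if "p \<in> triangle \<alpha> t" for p
      proof -
        have "l p \<le> zero p" "m p \<le> zero p" "r p \<le> zero p"
          by (rule le_on[OF that]; use 4 in \<open>auto simp: aff t' le one simp del: pos.simps\<close>)+
        then show ?thesis by (simp add: h_def max_def)
      qed
      with aff(4) show ?thesis by (rule affine_fun_on_real_affine)
    qed
  qed
qed

text \<open>
  The triangles around a ring node form a convex quadrilateral, so the hat function is concave
  there: it is the minimum of the affine functions \<open>f\<close> (on the boundary triangle), \<open>l\<close>, \<open>r\<close>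
  (on the corner triangles) and \<open>b\<close> (on both central triangles), cut off at zero. On every other
  triangle one of these functions is nonpositive.
\<close>

lemma has_nodal_function_O1:
  assumes \<alpha>: "0 < \<alpha>" "\<alpha> < 1"
  shows "has_nodal_function \<alpha> O1"
proof -
  define f where "f = (\<lambda>p :: point. (1 + 1 * fst p + 0 * snd p) / (1 - \<alpha>))"
  define l where "l = (\<lambda>p :: point. (\<alpha> + (\<alpha> - 1) * fst p + 1 * snd p) / (\<alpha> * (2 - \<alpha>)))"
  define r where "r = (\<lambda>p :: point. (\<alpha> + (\<alpha> - 1) * fst p + (-1) * snd p) / (\<alpha> * (2 - \<alpha>)))"
  define b where "b = (\<lambda>p :: point. (0 + (-1) * fst p + 0 * snd p) / \<alpha>)"
  define zero where "zero = (\<lambda>p :: point. (0 + 0 * fst p + 0 * snd p) / 1 :: real)"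
  have aff: "real_affine f" "real_affine l" "real_affine r" "real_affine b" "real_affine zero"
    unfolding f_def l_def r_def b_def zero_def by (rule real_affineI)+
  define h where "h = (\<lambda>p. max (zero p) (min (min (f p) (l p)) (min (r p) (b p))))"
  have one: "f (pos \<alpha> O1) = 1" "l (pos \<alpha> O1) = 1" "r (pos \<alpha> O1) = 1" "b (pos \<alpha> O1) = 1"
    "\<And>z. zero (pos \<alpha> z) = 0" "f (pos \<alpha> G1) = 0" "f (pos \<alpha> G4) = 0" "l (pos \<alpha> G1) = 0" "l (pos \<alpha> O2) = 0"
    "r (pos \<alpha> G4) = 0" "r (pos \<alpha> O4) = 0" "b (pos \<alpha> O2) = 0" "b (pos \<alpha> O4) = 0" "b (pos \<alpha> O5) = 0"
    using \<alpha> by (simp_all add: f_def l_def r_def b_def zero_def divide_eq_eq) (simp_all add: algebra_simps)?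
  have aa: "\<alpha> * \<alpha> \<ge> 0" "\<alpha> * \<alpha> \<le> \<alpha>" using \<alpha> by (auto simp: mult_left_le)
  have ge: "0 \<le> f (pos \<alpha> z)" for z
    using \<alpha> by (cases z; simp add: f_def zero_le_divide_iff zero_le_mult_iff algebra_simps)
  have ge2: "0 \<le> l (pos \<alpha> z)" if "z \<noteq> G2" for z
    using \<alpha> aa that by (cases z; simp add: l_def zero_le_divide_iff zero_le_mult_iff algebra_simps)
  have ge3: "0 \<le> r (pos \<alpha> z)" if "z \<noteq> G3" for z
    using \<alpha> aa that by (cases z; simp add: r_def zero_le_divide_iff zero_le_mult_iff algebra_simps)
  have ge4: "0 \<le> b (pos \<alpha> z)" if "z \<notin> {G2, G3, O3}" for z
    using \<alpha> that by (cases z; simp add: b_def zero_le_divide_iff zero_le_mult_iff algebra_simps)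
  have le: "l (pos \<alpha> G2) \<le> 0" "r (pos \<alpha> G3) \<le> 0" "b (pos \<alpha> G2) \<le> 0" "b (pos \<alpha> G3) \<le> 0" "b (pos \<alpha> O3) \<le> 0"
    using \<alpha> aa by (simp_all add: l_def r_def b_def divide_le_0_iff zero_le_mult_iff mult_le_0_iff algebra_simps)
  show ?thesis
  proof (rule has_nodal_functionI[OF _ \<alpha>])
    show "continuous_on UNIV h" unfolding h_def by (intro continuous_intros continuous_real_affine aff)
    show "h (pos \<alpha> y) = (if y = O1 then 1 else 0)" for y
      using ge[of y] ge2[of y] ge3[of y] ge4[of y] le by (cases y) (auto simp: h_def one min_def max_def simp del: pos.simps)
    fix t assume t: "t \<in> set triangles"
    obtain i j k where t': "t = (i, j, k)" by (cases t)
    note le_on = real_affine_le_triangle[where i = i and j = j and k = k and \<alpha> = \<alpha>, folded t', rotated 2]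
    consider "t = (G4, G1, O1)" | "t = (G1, O2, O1)" | "t = (G4, O1, O4)"
      | "t \<in> {(O5, O1, O2), (O5, O4, O1)}" | "t = (G1, G2, O2)" | "t = (G3, G4, O4)"
      | "t \<in> {(G2, G3, O3), (G2, O3, O2), (G3, O4, O3), (O5, O2, O3), (O5, O3, O4)}"
      using t unfolding triangles_def by auto
    then show "affine_fun_on (triangle \<alpha> t) (\<lambda>p. of_real (h p))"
    proof cases
      case 1
      have "h p = f p" if "p \<in> triangle \<alpha> t" for p
      proof -
        have "f p \<le> l p" "f p \<le> r p" "f p \<le> b p" "zero p \<le> f p"
          by (rule le_on[OF that]; use 1 in \<open>auto simp: aff t' ge ge2 ge3 ge4 one simp del: pos.simps\<close>)+
        then show ?thesis by (simp add: h_def min_def max_def)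
      qed
      with aff(1) show ?thesis by (rule affine_fun_on_real_affine)
    next
      case 2
      have "h p = l p" if "p \<in> triangle \<alpha> t" for p
      proof -
        have "l p \<le> f p" "l p \<le> r p" "l p \<le> b p" "zero p \<le> l p"
          by (rule le_on[OF that]; use 2 in \<open>auto simp: aff t' ge ge2 ge3 ge4 one simp del: pos.simps\<close>)+
        then show ?thesis by (simp add: h_def min_def max_def)
      qed
      with aff(2) show ?thesis by (rule affine_fun_on_real_affine)
    next
      case 3
      have "h p = r p" if "p \<in> triangle \<alpha> t" for p
      proof -
        have "r p \<le> f p" "r p \<le> l p" "r p \<le> b p" "zero p \<le> r p"
          by (rule le_on[OF that]; use 3 in \<open>auto simp: aff t' ge ge2 ge3 ge4 one simp del: pos.simps\<close>)+
        then show ?thesis by (simp add: h_def min_def max_def)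
      qed
      with aff(3) show ?thesis by (rule affine_fun_on_real_affine)
    next
      case 4
      have "h p = b p" if "p \<in> triangle \<alpha> t" for p
      proof -
        have "b p \<le> f p" "b p \<le> l p" "b p \<le> r p" "zero p \<le> b p"
          by (rule le_on[OF that]; use 4 in \<open>auto simp: aff t' ge ge2 ge3 ge4 one simp del: pos.simps\<close>)+
        then show ?thesis by (simp add: h_def min_def max_def)
      qed
      with aff(4) show ?thesis by (rule affine_fun_on_real_affine)
    next
      case 5
      have "h p = zero p" if "p \<in> triangle \<alpha> t" for p
      proof -
        have "l p \<le> zero p"
          by (rule le_on[OF that]; use 5 in \<open>auto simp: aff t' le one simp del: pos.simps\<close>)+
        then show ?thesis by (simp add: h_def min_def max_def)
      qed
      with aff(5) show ?thesis by (rule affine_fun_on_real_affine)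
    next
      case 6
      have "h p = zero p" if "p \<in> triangle \<alpha> t" for p
      proof -
        have "r p \<le> zero p"
          by (rule le_on[OF that]; use 6 in \<open>auto simp: aff t' le one simp del: pos.simps\<close>)+
        then show ?thesis by (simp add: h_def min_def max_def)
      qed
      with aff(5) show ?thesis by (rule affine_fun_on_real_affine)
    next
      case 7
      have "h p = zero p" if "p \<in> triangle \<alpha> t" for p
      proof -
        have "b p \<le> zero p"
          by (rule le_on[OF that]; use 7 in \<open>auto simp: aff t' le one simp del: pos.simps\<close>)+
        then show ?thesis by (simp add: h_def min_def max_def)
      qed
      with aff(5) show ?thesis by (rule affine_fun_on_real_affine)
    qed
  qed
qed

text \<open>
  The mesh is invariant under the quarter turn, so one corner and one ring node are enough.
\<close>

definition quarter_turn :: "point \<Rightarrow> point" where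
  "quarter_turn p = (- snd p, fst p)"

fun rot_node :: "node \<Rightarrow> node" where
  "rot_node G1 = G2" | "rot_node G2 = G3" | "rot_node G3 = G4" | "rot_node G4 = G1"
| "rot_node O1 = O2" | "rot_node O2 = O3" | "rot_node O3 = O4" | "rot_node O4 = O1"
| "rot_node O5 = O5"

lemma quarter_turn_pos: "quarter_turn (pos \<alpha> z) = pos \<alpha> (rot_node z)"
  by (cases z) (auto simp: quarter_turn_def)

lemma linear_quarter_turn: "linear quarter_turn"
  by (rule linearI) (auto simp: quarter_turn_def)

lemma quarter_turn_closure_dom: "quarter_turn p \<in> closure dom \<longleftrightarrow> p \<in> closure dom"
  by (cases p) (auto simp: closure_dom quarter_turn_def)

lemma quarter_turn_triangle: "quarter_turn ` triangle \<alpha> (a, b, c) = triangle \<alpha> (rot_node a, rot_node b, rot_node c)"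
  by (simp only: triangle.simps convex_hull_linear_image[OF linear_quarter_turn] image_insert image_empty quarter_turn_pos)

lemma quarter_turn_triangles: "(a, b, c) \<in> set triangles \<Longrightarrow> (rot_node a, rot_node b, rot_node c) \<in> set triangles"
  by (cases a; cases b; cases c; simp add: triangles_def)

lemma fe_space_quarter_turn:
  assumes u: "u \<in> fe_space \<alpha>"
  shows "(\<lambda>p. u (quarter_turn p)) \<in> fe_space \<alpha>"
proof -
  have "continuous_on (closure dom) (\<lambda>p. u (quarter_turn p))"
  proof (rule continuous_on_compose2[of "closure dom" u])
    show "continuous_on (closure dom) quarter_turn" unfolding quarter_turn_def by (intro continuous_intros)
    show "continuous_on (closure dom) u" using u unfolding fe_space_def by blast
    show "quarter_turn ` closure dom \<subseteq> closure dom" using quarter_turn_closure_dom by blast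
  qed
  moreover have "affine_fun_on (triangle \<alpha> t) (\<lambda>p. u (quarter_turn p))" if "t \<in> set triangles" for t
  proof -
    obtain a b c where t: "t = (a, b, c)" by (cases t)
    have "affine_fun_on (quarter_turn ` triangle \<alpha> t) u"
      unfolding t quarter_turn_triangle using that unfolding t
      by (intro fe_space_affine[OF u] quarter_turn_triangles)
    then obtain d f where f: "linear f" "\<forall>p\<in>triangle \<alpha> t. u (quarter_turn p) = d + f (quarter_turn p)"
      unfolding affine_fun_on_def by auto
    moreover have "linear (\<lambda>p. f (quarter_turn p))"
      using linear_compose[OF linear_quarter_turn f(1)] by (simp add: o_def)
    ultimately show ?thesis unfolding affine_fun_on_def by blast
  qed
  moreover have "u (quarter_turn p) = 0" if "p \<notin> closure dom" for p
    using u that quarter_turn_closure_dom[of p] by (simp only: fe_space_def mem_Collect_eq) blast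
  ultimately show ?thesis unfolding fe_space_def mesh_eq by blast
qed

lemma has_nodal_function_quarter_turn:
  assumes "has_nodal_function \<alpha> (rot_node z)"
  shows "has_nodal_function \<alpha> z"
proof -
  obtain b where b: "b \<in> fe_space \<alpha>" "\<And>y. b (pos \<alpha> y) = (if y = rot_node z then 1 else 0)"
    using assms unfolding has_nodal_function_def by blast
  have "rot_node y = rot_node z \<longleftrightarrow> y = z" for y by (cases y; cases z) auto
  with b fe_space_quarter_turn[OF b(1)] show ?thesis
    unfolding has_nodal_function_def by (intro bexI[of _ "\<lambda>p. b (quarter_turn p)"]) (auto simp: quarter_turn_pos)
qed

text \<open>
  The hat function of the centre is the constant one minus all other hat functions.
\<close>

lemma has_nodal_function:
  assumes \<alpha>: "0 < \<alpha>" "\<alpha> < 1"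
  shows "has_nodal_function \<alpha> z"
proof -
  note R = has_nodal_function_quarter_turn[of \<alpha>]
  have G: "has_nodal_function \<alpha> G1" "has_nodal_function \<alpha> G4" "has_nodal_function \<alpha> G3" "has_nodal_function \<alpha> G2"
    using has_nodal_function_G1[OF \<alpha>] R[of G4] R[of G3] R[of G2] by auto
  have O: "has_nodal_function \<alpha> O1" "has_nodal_function \<alpha> O4" "has_nodal_function \<alpha> O3" "has_nodal_function \<alpha> O2"
    using has_nodal_function_O1[OF \<alpha>] R[of O4] R[of O3] R[of O2] by auto
  have not5: "has_nodal_function \<alpha> y" if "y \<noteq> O5" for y using G O that by (cases y) auto
  then have "\<forall>y\<in>UNIV - {O5}. \<exists>b. b \<in> fe_space \<alpha> \<and> (\<forall>x. b (pos \<alpha> x) = (if x = y then 1 else 0))"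
    unfolding has_nodal_function_def by blast
  from bchoice[OF this] obtain b where
    "\<forall>y\<in>UNIV - {O5}. b y \<in> fe_space \<alpha> \<and> (\<forall>x. b y (pos \<alpha> x) = (if x = y then 1 else 0))"
    by blast
  then have b: "\<And>y. y \<in> UNIV - {O5} \<Longrightarrow> b y \<in> fe_space \<alpha>"
    "\<And>y x. y \<in> UNIV - {O5} \<Longrightarrow> b y (pos \<alpha> x) = (if x = y then 1 else 0)"
    by blast+
  have "(\<lambda>p. if p \<in> closure dom then of_real 1 else 0) \<in> fe_space \<alpha>"
    by (rule fe_space_piecewise[OF _ _ \<alpha>]) (auto simp: affine_fun_on_const)
  then have one: "(\<lambda>p. if p \<in> closure dom then 1 else 0) \<in> fe_space \<alpha>"
    by (simp only: of_real_1)
  let ?s = "\<lambda>p. (if p \<in> closure dom then 1 else 0) + (-1) * (\<Sum>y\<in>UNIV - {O5}. b y p)"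
  have "?s \<in> fe_space \<alpha>"
    using b(1) by (intro fe_space_add fe_space_mult fe_space_sum one) auto
  moreover have "?s (pos \<alpha> x) = (if x = O5 then 1 else 0)" for x
  proof -
    have "(\<Sum>y\<in>UNIV - {O5}. b y (pos \<alpha> x)) = (\<Sum>y\<in>UNIV - {O5}. if x = y then 1 else 0)"
      by (intro sum.cong refl b(2))
    also have "\<dots> = (if x \<in> UNIV - {O5} then 1 else 0)" by (rule sum.delta') simp
    finally show ?thesis using pos_in_closure[OF \<alpha>] by simp
  qed
  ultimately have "has_nodal_function \<alpha> O5"
    unfolding has_nodal_function_def by (intro bexI[of _ ?s] allI)
  with not5 show ?thesis by (cases "z = O5") simp_all
qed

lemma hat:
  assumes \<alpha>: "0 < \<alpha>" "\<alpha> < 1"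
  shows hat_in_fe_space: "hat \<alpha> z \<in> fe_space \<alpha>"
    and hat_pos: "hat \<alpha> z (pos \<alpha> y) = (if y = z then 1 else 0)"
proof -
  obtain b where b: "b \<in> fe_space \<alpha>" "\<forall>y. b (pos \<alpha> y) = (if y = z then 1 else 0)"
    using has_nodal_function[OF \<alpha>] unfolding has_nodal_function_def by blast
  have "hat \<alpha> z \<in> fe_space \<alpha> \<and> (\<forall>y. hat \<alpha> z (pos \<alpha> y) = (if y = z then 1 else 0))"
    unfolding hat_def by (rule theI[of _ b]) (use b in \<open>auto intro: fe_space_eqI[OF \<alpha>]\<close>)
  then show "hat \<alpha> z \<in> fe_space \<alpha>" "hat \<alpha> z (pos \<alpha> y) = (if y = z then 1 else 0)" by auto
qed

definition interpolant :: "real \<Rightarrow> (node \<Rightarrow> complex) \<Rightarrow> point \<Rightarrow> complex" where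
  "interpolant \<alpha> x = (\<lambda>p. \<Sum>z\<in>UNIV. x z * hat \<alpha> z p)"

lemma interpolant_in_fe_space: "0 < \<alpha> \<Longrightarrow> \<alpha> < 1 \<Longrightarrow> interpolant \<alpha> x \<in> fe_space \<alpha>"
  unfolding interpolant_def by (rule fe_space_sum[OF finite]) (rule fe_space_mult[OF hat_in_fe_space])

lemma interpolant_pos:
  assumes "0 < \<alpha>" "\<alpha> < 1"
  shows "interpolant \<alpha> x (pos \<alpha> z) = x z"
proof -
  have "(\<Sum>y\<in>UNIV. x y * hat \<alpha> y (pos \<alpha> z)) = (\<Sum>y\<in>UNIV. if z = y then x y else 0)"
    by (intro sum.cong refl) (simp add: hat_pos[OF assms])
  then show ?thesis by (simp add: interpolant_def)
qed

section \<open>The form on functions that vanish at the corners\<close>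

definition alternating :: "node \<Rightarrow> complex" where
  "alternating z = (case z of O1 \<Rightarrow> 1 | O2 \<Rightarrow> -1 | O3 \<Rightarrow> 1 | O4 \<Rightarrow> -1 | _ \<Rightarrow> 0)"

text \<open>
  The shape of the stiffness and mass forms, dictated by the symmetry of the mesh, when the corner
  values of \<open>x\<close> are zero: \<open>g\<close> couples a corner to an adjacent ring node, \<open>d\<close> a ring node to
  itself, \<open>n\<close> two adjacent ring nodes, \<open>c\<close> a ring node to the centre, and \<open>m\<close> the centre to
  itself. Opposite ring nodes share no triangle.
\<close>

definition interior_form :: "complex \<Rightarrow> complex \<Rightarrow> complex \<Rightarrow> complex \<Rightarrow> complex \<Rightarrow>
    (node \<Rightarrow> complex) \<Rightarrow> (node \<Rightarrow> complex) \<Rightarrow> complex" where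
  "interior_form g d n c m x y =
     g * ((x O1 + x O2) * cnj (y G1) + (x O2 + x O3) * cnj (y G2) +
          (x O3 + x O4) * cnj (y G3) + (x O4 + x O1) * cnj (y G4)) +
     (d * x O1 + n * (x O4 + x O2) + c * x O5) * cnj (y O1) +
     (d * x O2 + n * (x O1 + x O3) + c * x O5) * cnj (y O2) +
     (d * x O3 + n * (x O2 + x O4) + c * x O5) * cnj (y O3) +
     (d * x O4 + n * (x O3 + x O1) + c * x O5) * cnj (y O4) +
     (c * (x O1 + x O2 + x O3 + x O4) + m * x O5) * cnj (y O5)"

lemma of_real_double_area:
  fixes \<alpha> :: real
  defines "a \<equiv> complex_of_real \<alpha>"
  shows "complex_of_real (double_area \<alpha> (G4, G1, O1)) = 2 * (1 - a)" "complex_of_real (double_area \<alpha> (G1, G2, O2)) = 2 * (1 - a)"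
    "complex_of_real (double_area \<alpha> (G2, G3, O3)) = 2 * (1 - a)" "complex_of_real (double_area \<alpha> (G3, G4, O4)) = 2 * (1 - a)"
    "complex_of_real (double_area \<alpha> (G1, O2, O1)) = a * (2 - a)" "complex_of_real (double_area \<alpha> (G2, O3, O2)) = a * (2 - a)"
    "complex_of_real (double_area \<alpha> (G3, O4, O3)) = a * (2 - a)" "complex_of_real (double_area \<alpha> (G4, O1, O4)) = a * (2 - a)"
    "complex_of_real (double_area \<alpha> (O5, O1, O2)) = a * a" "complex_of_real (double_area \<alpha> (O5, O2, O3)) = a * a"
    "complex_of_real (double_area \<alpha> (O5, O3, O4)) = a * a" "complex_of_real (double_area \<alpha> (O5, O4, O1)) = a * a"
  by (simp_all add: orient_def a_def algebra_simps)

lemma local_mass_sum: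
  fixes \<alpha> :: real
  defines "a \<equiv> complex_of_real \<alpha>"
  assumes x: "x G1 = 0" "x G2 = 0" "x G3 = 0" "x G4 = 0"
  shows "(\<Sum>t\<leftarrow>triangles. local_mass \<alpha> x y t) =
    interior_form ((2 * (1 - a) + a * (2 - a)) / 24) ((1 + a) / 6) (a / 12) (a * a / 12) (a * a / 3) x y"
proof -
  show ?thesis
    unfolding triangles_def list.map sum_list.Cons sum_list.Nil local_mass.simps of_real_double_area a_def[symmetric]
    by (simp add: interior_form_def x field_simps)
qed

text \<open>
  Written with the reciprocals \<open>p\<close> and \<open>q\<close> as unknowns, the identity is one between
  polynomials.
\<close>

lemma local_stiffness_sum:
  fixes \<alpha> :: real
  defines "a \<equiv> complex_of_real \<alpha>"
  assumes x: "x G1 = 0" "x G2 = 0" "x G3 = 0" "x G4 = 0" and \<alpha>: "0 < \<alpha>" "\<alpha> < 1"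
  shows "(\<Sum>t\<leftarrow>triangles. local_stiffness \<alpha> x y t) =
    interior_form (- 1 / (2 * (1 - a)) - a / (2 * (2 - a))) (1 / (1 - a) + 1 + ((1 - a) * (1 - a) + 1) / (a * (2 - a)))
      (- (1 - a) / (a * (2 - a))) (-1) 4 x y"
proof -
  define p q where "p = 1 / (1 - a)" and "q = 1 / (a * (2 - a))"
  have ne: "a \<noteq> 0" "1 - a \<noteq> 0" "2 - a \<noteq> 0"
  proof -
    have "1 - a = of_real (1 - \<alpha>)" "2 - a = of_real (2 - \<alpha>)" by (simp_all add: a_def)
    then show "a \<noteq> 0" "1 - a \<noteq> 0" "2 - a \<noteq> 0" using \<alpha> by (simp_all add: a_def del: of_real_diff)
  qed
  let ?N = "\<lambda>t. grad_x \<alpha> x t * cnj (grad_x \<alpha> y t) + grad_y \<alpha> x t * cnj (grad_y \<alpha> y t)"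
  have N: "?N (G4, G1, O1) = 2 * x O1 * cnj (2 * y O1 - y G4 - y G1)"
    "?N (G1, G2, O2) = 2 * x O2 * cnj (2 * y O2 - y G1 - y G2)"
    "?N (G2, G3, O3) = 2 * x O3 * cnj (2 * y O3 - y G2 - y G3)"
    "?N (G3, G4, O4) = 2 * x O4 * cnj (2 * y O4 - y G3 - y G4)"
    "?N (G1, O2, O1) = (x O2 - (1 - a) * x O1) * cnj (y O2 - (1 - a) * y O1 - a * y G1) +
      (x O1 - (1 - a) * x O2) * cnj (y O1 - (1 - a) * y O2 - a * y G1)"
    "?N (G2, O3, O2) = (x O3 - (1 - a) * x O2) * cnj (y O3 - (1 - a) * y O2 - a * y G2) +
      (x O2 - (1 - a) * x O3) * cnj (y O2 - (1 - a) * y O3 - a * y G2)"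
    "?N (G3, O4, O3) = (x O4 - (1 - a) * x O3) * cnj (y O4 - (1 - a) * y O3 - a * y G3) +
      (x O3 - (1 - a) * x O4) * cnj (y O3 - (1 - a) * y O4 - a * y G3)"
    "?N (G4, O1, O4) = (x O1 - (1 - a) * x O4) * cnj (y O1 - (1 - a) * y O4 - a * y G4) +
      (x O4 - (1 - a) * x O1) * cnj (y O4 - (1 - a) * y O1 - a * y G4)"
    "?N (O5, O1, O2) = a * a * ((x O5 - x O1) * cnj (y O5 - y O1) + (x O5 - x O2) * cnj (y O5 - y O2))"
    "?N (O5, O2, O3) = a * a * ((x O5 - x O2) * cnj (y O5 - y O2) + (x O5 - x O3) * cnj (y O5 - y O3))"
    "?N (O5, O3, O4) = a * a * ((x O5 - x O3) * cnj (y O5 - y O3) + (x O5 - x O4) * cnj (y O5 - y O4))"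
    "?N (O5, O4, O1) = a * a * ((x O5 - x O4) * cnj (y O5 - y O4) + (x O5 - x O1) * cnj (y O5 - y O1))"
    by (simp_all add: grad_x_def grad_y_def x a_def algebra_simps)
  have div: "z / (2 * (2 * (1 - a))) = p / 4 * z" "z / (2 * (a * (2 - a))) = q / 2 * z"
    "a * a * z / (2 * (a * a)) = z / 2" for z
    using ne by (simp_all add: p_def q_def)
  have coeffs: "- 1 / (2 * (1 - a)) - a / (2 * (2 - a)) = - p / 2 - a * a * q / 2"
    "1 / (1 - a) + 1 + ((1 - a) * (1 - a) + 1) / (a * (2 - a)) = p + 1 + ((1 - a) * (1 - a) + 1) * q"
    "- (1 - a) / (a * (2 - a)) = - (1 - a) * q"
    using ne by (simp_all add: p_def q_def mult.commute)
  have "cnj a = a" by (simp add: a_def)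
  then show ?thesis
    unfolding triangles_def list.map sum_list.Cons sum_list.Nil local_stiffness_def of_real_mult of_real_numeral
      of_real_double_area a_def[symmetric] N div coeffs
    by (simp add: interior_form_def field_simps)
qed

lemma local_boundary_sum_self:
  "(\<Sum>e\<leftarrow>sides. local_boundary x x e) = of_real ((norm (x G1 + x G2))\<^sup>2 + (norm (x G2 + x G3))\<^sup>2 +
     (norm (x G3 + x G4))\<^sup>2 + (norm (x G4 + x G1))\<^sup>2 +
     2 * ((norm (x G1))\<^sup>2 + (norm (x G2))\<^sup>2 + (norm (x G3))\<^sup>2 + (norm (x G4))\<^sup>2)) / 3"
  by (simp add: sides_def complex_norm_square field_simps del: of_real_power)

lemma mult_cnj_self_real: "z * cnj z \<in> \<real>"
  by (simp add: complex_is_Real_iff)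

lemma sum_list_real: "(\<And>t. t \<in> set ts \<Longrightarrow> f t \<in> \<real>) \<Longrightarrow> (\<Sum>t\<leftarrow>ts. f t) \<in> (\<real> :: complex set)"
  by (induction ts) auto

section \<open>The kernel of the form\<close>

text \<open>
  The imaginary part of the form at \<open>(x, x)\<close> is \<open>- k\<close> times the squared boundary norm, which
  dominates the corner values.
\<close>

lemma discrete_form_boundary_zero:
  assumes k: "k \<noteq> 0" and 0: "discrete_form \<alpha> k x x = 0"
  shows "x G1 = 0" "x G2 = 0" "x G3 = 0" "x G4 = 0"
proof -
  have "local_mass \<alpha> x x t \<in> \<real>" for t
    by (cases t) (simp only: local_mass.simps, intro Reals_mult Reals_add Reals_divide mult_cnj_self_real Reals_of_real Reals_numeral)
  then have M: "Im (\<Sum>t\<leftarrow>triangles. local_mass \<alpha> x x t) = 0"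
    using sum_list_real by (metis complex_is_Real_iff)
  have "local_stiffness \<alpha> x x t \<in> \<real>" for t
    unfolding local_stiffness_def by (intro Reals_mult Reals_add Reals_divide mult_cnj_self_real Reals_of_real)
  then have S: "Im (\<Sum>t\<leftarrow>triangles. local_stiffness \<alpha> x x t) = 0"
    using sum_list_real by (metis complex_is_Real_iff)
  have "Im (discrete_form \<alpha> k x x) = - k * Re (\<Sum>e\<leftarrow>sides. local_boundary x x e)"
    unfolding discrete_form_def by (simp add: M S)
  then have "Re (\<Sum>e\<leftarrow>sides. local_boundary x x e) = 0" using 0 k by simp
  then have *: "(norm (x G1 + x G2))\<^sup>2 + (norm (x G2 + x G3))\<^sup>2 +
     (norm (x G3 + x G4))\<^sup>2 + (norm (x G4 + x G1))\<^sup>2 +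
     2 * ((norm (x G1))\<^sup>2 + (norm (x G2))\<^sup>2 + (norm (x G3))\<^sup>2 + (norm (x G4))\<^sup>2) = 0"
    unfolding local_boundary_sum_self by (simp only: Re_divide_numeral Re_complex_of_real) simp
  then show "x G1 = 0" "x G2 = 0" "x G3 = 0" "x G4 = 0"
    by (simp_all add: add_nonneg_eq_0_iff)
qed

text \<open>
  The coefficients of \<open>interior_form\<close> for the Helmholtz form: tip for a corner and an adjacent ring
  node, diagonal and ring for the ring nodes, hub for a ring node and the centre.
\<close>

definition tip_coupling :: "real \<Rightarrow> real \<Rightarrow> real" where
  "tip_coupling \<alpha> k = - 1 / (2 * (1 - \<alpha>)) - \<alpha> / (2 * (2 - \<alpha>)) - k\<^sup>2 * ((2 * (1 - \<alpha>) + \<alpha> * (2 - \<alpha>)) / 24)"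

definition diag_coupling :: "real \<Rightarrow> real \<Rightarrow> real" where
  "diag_coupling \<alpha> k = 1 / (1 - \<alpha>) + 1 + ((1 - \<alpha>) * (1 - \<alpha>) + 1) / (\<alpha> * (2 - \<alpha>)) - k\<^sup>2 * ((1 + \<alpha>) / 6)"

definition ring_coupling :: "real \<Rightarrow> real \<Rightarrow> real" where
  "ring_coupling \<alpha> k = - (1 - \<alpha>) / (\<alpha> * (2 - \<alpha>)) - k\<^sup>2 * (\<alpha> / 12)"

definition hub_coupling :: "real \<Rightarrow> real \<Rightarrow> real" where
  "hub_coupling \<alpha> k = - 1 - k\<^sup>2 * (\<alpha> * \<alpha> / 12)"

lemma discrete_form_interior:
  assumes x: "x G1 = 0" "x G2 = 0" "x G3 = 0" "x G4 = 0" and \<alpha>: "0 < \<alpha>" "\<alpha> < 1"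
  shows "discrete_form \<alpha> k x y = interior_form (of_real (tip_coupling \<alpha> k)) (of_real (diag_coupling \<alpha> k))
     (of_real (ring_coupling \<alpha> k)) (of_real (hub_coupling \<alpha> k)) (of_real (4 - k\<^sup>2 * (\<alpha> * \<alpha> / 3))) x y"
proof -
  have B: "(\<Sum>e\<leftarrow>sides. local_boundary x y e) = 0" by (simp add: sides_def x)
  have comb: "interior_form g d n c m x y - K * interior_form g' d' n' c' m' x y =
     interior_form (g - K * g') (d - K * d') (n - K * n') (c - K * c') (m - K * m') x y"
    for g d n c m K g' d' n' c' m'
    by (simp add: interior_form_def algebra_simps)
  show ?thesis
    unfolding discrete_form_def B local_stiffness_sum[OF x \<alpha>] local_mass_sum[OF x] comb
      tip_coupling_def diag_coupling_def ring_coupling_def hub_coupling_def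
    by simp
qed

lemma tip_coupling_neg:
  assumes "0 < \<alpha>" "\<alpha> < 1"
  shows "tip_coupling \<alpha> k < 0"
proof -
  have "- 1 / (2 * (1 - \<alpha>)) < 0" "\<alpha> / (2 * (2 - \<alpha>)) > 0" "k\<^sup>2 * ((2 * (1 - \<alpha>) + \<alpha> * (2 - \<alpha>)) / 24) \<ge> 0"
    using assms by simp_all
  then show ?thesis unfolding tip_coupling_def by linarith
qed

lemma hub_coupling_neg: "hub_coupling \<alpha> k < 0"
proof -
  have "k\<^sup>2 * (\<alpha> * \<alpha> / 12) \<ge> 0" by simp
  then show ?thesis unfolding hub_coupling_def by linarith
qed

text \<open>
  The coefficient of the form at the alternating vector. Only here do the exact values of the
  entries matter; of the tip and hub couplings only the sign does.
\<close>

lemma alternating_coupling: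
  assumes "0 < \<alpha>" "\<alpha> < 1"
  shows "diag_coupling \<alpha> k - 2 * ring_coupling \<alpha> k = (2 - \<alpha>) / (\<alpha> * (1 - \<alpha>)) - k\<^sup>2 / 6"
proof -
  have "1 / (1 - \<alpha>) + 1 + ((1 - \<alpha>) * (1 - \<alpha>) + 1) / (\<alpha> * (2 - \<alpha>)) + 2 * (1 - \<alpha>) / (\<alpha> * (2 - \<alpha>)) =
    (2 - \<alpha>) / (\<alpha> * (1 - \<alpha>))" (is "?l = ?r")
  proof -
    have eq: "?l * (\<alpha> * (1 - \<alpha>) * (2 - \<alpha>)) = ?r * (\<alpha> * (1 - \<alpha>) * (2 - \<alpha>))"
      using assms by (simp add: divide_simps) (simp add: algebra_simps)
    have "\<alpha> * (1 - \<alpha>) * (2 - \<alpha>) \<noteq> 0" using assms by simp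
    from mult_right_cancel[OF this, THEN iffD1, OF eq] show ?thesis .
  qed
  moreover have "2 * (- (1 - \<alpha>) / (\<alpha> * (2 - \<alpha>))) = - (2 * (1 - \<alpha>) / (\<alpha> * (2 - \<alpha>)))"
    by (simp only: minus_divide_left[symmetric] mult_minus_right times_divide_eq_right)
  moreover have "k\<^sup>2 * ((1 + \<alpha>) / 6) - 2 * (k\<^sup>2 * (\<alpha> / 12)) = k\<^sup>2 / 6" by (simp add: field_simps)
  ultimately show ?thesis unfolding diag_coupling_def ring_coupling_def right_diff_distrib by linarith
qed

lemma k_crit_pos:
  assumes "0 < \<alpha>" "\<alpha> < 1"
  shows "k_crit \<alpha> > 0"
  using assms by (simp add: k_crit_def)

lemma alternating_coupling_zero_iff:
  assumes \<alpha>: "0 < \<alpha>" "\<alpha> < 1"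
  shows "diag_coupling \<alpha> k - 2 * ring_coupling \<alpha> k = 0 \<longleftrightarrow> k = k_crit \<alpha> \<or> k = - k_crit \<alpha>"
proof -
  have "(k_crit \<alpha>)\<^sup>2 = 6 * ((2 - \<alpha>) / (\<alpha> * (1 - \<alpha>)))"
    using \<alpha> by (simp add: k_crit_def)
  moreover have "v - w / 6 = 0 \<longleftrightarrow> w = 6 * v" for v w :: real by auto
  ultimately have "diag_coupling \<alpha> k - 2 * ring_coupling \<alpha> k = 0 \<longleftrightarrow> k\<^sup>2 = (k_crit \<alpha>)\<^sup>2"
    unfolding alternating_coupling[OF \<alpha>] by metis
  then show ?thesis by (simp only: power2_eq_iff)
qed

definition unit_at :: "node \<Rightarrow> node \<Rightarrow> complex" where
  "unit_at z = (\<lambda>y. if y = z then 1 else 0)"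

text \<open>
  The corner equations make the ring values alternate. The equations of \<open>O1\<close> and \<open>O2\<close> then differ only
  in the sign of the alternating part, so their sum isolates the value at \<open>O5\<close>.
\<close>

lemma discrete_form_kernel:
  assumes \<alpha>: "0 < \<alpha>" "\<alpha> < 1" and k: "k \<noteq> 0"
  shows "(\<forall>y. discrete_form \<alpha> k x y = 0) \<longleftrightarrow>
    x = (\<lambda>z. x O1 * alternating z) \<and> (x O1 = 0 \<or> k = k_crit \<alpha> \<or> k = - k_crit \<alpha>)" (is "?L \<longleftrightarrow> ?R")
proof
  let ?g = "complex_of_real (tip_coupling \<alpha> k)" and ?d = "complex_of_real (diag_coupling \<alpha> k)"
    and ?n = "complex_of_real (ring_coupling \<alpha> k)" and ?c = "complex_of_real (hub_coupling \<alpha> k)"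
  assume L: ?L
  note x = discrete_form_boundary_zero[OF k L[rule_format]]
  have L': "interior_form ?g ?d ?n ?c (of_real (4 - k\<^sup>2 * (\<alpha> * \<alpha> / 3))) x (unit_at z) = 0" for z
    using L discrete_form_interior[OF x \<alpha>] by metis
  have g: "?g \<noteq> 0" and c: "?c \<noteq> 0" using tip_coupling_neg[OF \<alpha>] hub_coupling_neg by (metis of_real_eq_0_iff less_irrefl)+
  have "?g * (x O1 + x O2) = 0" "?g * (x O2 + x O3) = 0" "?g * (x O3 + x O4) = 0"
    using L'[of G1] L'[of G2] L'[of G3] by (simp_all add: interior_form_def unit_at_def)
  then have "x O1 + x O2 = 0" "x O2 + x O3 = 0" "x O3 + x O4 = 0" using g by simp_all
  then have alt: "x O2 = - x O1" "x O3 = x O1" "x O4 = - x O1"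
    by (simp_all add: add_eq_0_iff)
  have 1: "?d * x O1 + ?n * (- x O1 - x O1) + ?c * x O5 = 0"
    using L'[of O1] by (simp add: interior_form_def unit_at_def alt)
  have 2: "- ?d * x O1 + ?n * (x O1 + x O1) + ?c * x O5 = 0"
    using L'[of O2] by (simp add: interior_form_def unit_at_def alt)
  from 1 2 have "2 * (?c * x O5) = 0" by algebra
  with c have x5: "x O5 = 0" by simp
  with 1 have "(?d - 2 * ?n) * x O1 = 0" by (simp add: algebra_simps)
  then have "of_real (diag_coupling \<alpha> k - 2 * ring_coupling \<alpha> k) * x O1 = 0" by simp
  then have "x O1 = 0 \<or> diag_coupling \<alpha> k - 2 * ring_coupling \<alpha> k = 0"
    by (simp only: mult_eq_0_iff of_real_eq_0_iff) blast
  moreover have "x = (\<lambda>z. x O1 * alternating z)"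
  proof
    show "x z = x O1 * alternating z" for z by (cases z) (simp_all add: alternating_def x alt x5)
  qed
  ultimately show ?R unfolding alternating_coupling_zero_iff[OF \<alpha>] by blast
next
  assume R: ?R
  let ?w = "x O1"
  have x: "x z = ?w * alternating z" for z using R by metis
  have xs: "x G1 = 0" "x G2 = 0" "x G3 = 0" "x G4 = 0" "x O2 = - ?w" "x O3 = ?w" "x O4 = - ?w" "x O5 = 0"
    using x[of G1] x[of G2] x[of G3] x[of G4] x[of O2] x[of O3] x[of O4] x[of O5] by (simp_all add: alternating_def)
  have "?w = 0 \<or> diag_coupling \<alpha> k - 2 * ring_coupling \<alpha> k = 0"
    using R alternating_coupling_zero_iff[OF \<alpha>] by blast
  then have "?w = 0 \<or> complex_of_real (diag_coupling \<alpha> k) = 2 * complex_of_real (ring_coupling \<alpha> k)"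
    by (metis eq_iff_diff_eq_0 of_real_mult of_real_numeral)
  then show ?L
    unfolding discrete_form_interior[OF xs(1-4) \<alpha>] interior_form_def xs(5-8) by auto
qed

lemma discrete_form_linear:
  shows discrete_form_add_left: "discrete_form \<alpha> k (\<lambda>z. x z + x' z) y = discrete_form \<alpha> k x y + discrete_form \<alpha> k x' y"
    and discrete_form_mult_left: "discrete_form \<alpha> k (\<lambda>z. c * x z) y = c * discrete_form \<alpha> k x y"
    and discrete_form_add_right: "discrete_form \<alpha> k x (\<lambda>z. y z + y' z) = discrete_form \<alpha> k x y + discrete_form \<alpha> k x y'"
    and discrete_form_mult_right: "discrete_form \<alpha> k x (\<lambda>z. c * y z) = cnj c * discrete_form \<alpha> k x y"
proof -
  have g: "grad_x \<alpha> (\<lambda>z. x z + x' z) t = grad_x \<alpha> x t + grad_x \<alpha> x' t"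
    "grad_y \<alpha> (\<lambda>z. x z + x' z) t = grad_y \<alpha> x t + grad_y \<alpha> x' t"
    "grad_x \<alpha> (\<lambda>z. c * x z) t = c * grad_x \<alpha> x t"
    "grad_y \<alpha> (\<lambda>z. c * x z) t = c * grad_y \<alpha> x t" for x x' t c
    by (cases t; simp add: grad_x_def grad_y_def algebra_simps)+
  have S: "local_stiffness \<alpha> (\<lambda>z. x z + x' z) y t = local_stiffness \<alpha> x y t + local_stiffness \<alpha> x' y t"
    "local_stiffness \<alpha> (\<lambda>z. c * x z) y t = c * local_stiffness \<alpha> x y t"
    "local_stiffness \<alpha> x (\<lambda>z. y z + y' z) t = local_stiffness \<alpha> x y t + local_stiffness \<alpha> x y' t"
    "local_stiffness \<alpha> x (\<lambda>z. c * y z) t = cnj c * local_stiffness \<alpha> x y t" for t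
    unfolding local_stiffness_def g times_divide_eq_right add_divide_distrib[symmetric]
    by (rule arg_cong2[of _ _ _ _ "(/)", OF _ refl], simp add: algebra_simps)+
  have M: "local_mass \<alpha> (\<lambda>z. x z + x' z) y t = local_mass \<alpha> x y t + local_mass \<alpha> x' y t"
    "local_mass \<alpha> (\<lambda>z. c * x z) y t = c * local_mass \<alpha> x y t"
    "local_mass \<alpha> x (\<lambda>z. y z + y' z) t = local_mass \<alpha> x y t + local_mass \<alpha> x y' t"
    "local_mass \<alpha> x (\<lambda>z. c * y z) t = cnj c * local_mass \<alpha> x y t" for t
    by (cases t; simp add: algebra_simps del: double_area.simps)+
  have B: "local_boundary (\<lambda>z. x z + x' z) y t = local_boundary x y t + local_boundary x' y t"
    "local_boundary (\<lambda>z. c * x z) y t = c * local_boundary x y t"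
    "local_boundary x (\<lambda>z. y z + y' z) t = local_boundary x y t + local_boundary x y' t"
    "local_boundary x (\<lambda>z. c * y z) t = cnj c * local_boundary x y t" for t
    by (cases t; simp add: field_simps)+
  show "discrete_form \<alpha> k (\<lambda>z. x z + x' z) y = discrete_form \<alpha> k x y + discrete_form \<alpha> k x' y"
    "discrete_form \<alpha> k (\<lambda>z. c * x z) y = c * discrete_form \<alpha> k x y"
    "discrete_form \<alpha> k x (\<lambda>z. y z + y' z) = discrete_form \<alpha> k x y + discrete_form \<alpha> k x y'"
    "discrete_form \<alpha> k x (\<lambda>z. c * y z) = cnj c * discrete_form \<alpha> k x y"
    unfolding discrete_form_def S M B sum_list_addf sum_list_const_mult
    by (simp_all add: algebra_simps)
qed

lemma linear_eq_sum_unit: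
  fixes f :: "(node \<Rightarrow> complex) \<Rightarrow> complex"
  assumes add: "\<And>x y. f (\<lambda>z. x z + y z) = f x + f y" and mult: "\<And>c x. f (\<lambda>z. c * x z) = c * f x"
  shows "f x = (\<Sum>z\<in>UNIV. x z * f (unit_at z))"
proof -
  have "f (\<lambda>w. \<Sum>z\<in>A. x z * unit_at z w) = (\<Sum>z\<in>A. x z * f (unit_at z))" if "finite A" for A
    using that
  proof induction
    case empty
    show ?case using mult[of 0 "\<lambda>_. 0"] by simp
  next
    case (insert z A)
    then show ?case using add[of "\<lambda>w. x z * unit_at z w" "\<lambda>w. \<Sum>z\<in>A. x z * unit_at z w"] mult[of "x z" "unit_at z"] by simp
  qed
  from this[of UNIV] have "f (\<lambda>w. \<Sum>z\<in>UNIV. x z * unit_at z w) = (\<Sum>z\<in>UNIV. x z * f (unit_at z))" by simp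
  moreover have "(\<lambda>w. \<Sum>z\<in>UNIV. x z * unit_at z w) = x"
  proof
    fix w
    have "(\<Sum>z\<in>UNIV. x z * unit_at z w) = (\<Sum>z\<in>UNIV. if w = z then x z else 0)"
      by (intro sum.cong refl) (simp add: unit_at_def)
    then show "(\<Sum>z\<in>UNIV. x z * unit_at z w) = x w" by simp
  qed
  ultimately show ?thesis by simp
qed

lemma antilinear_eq_sum_unit:
  fixes f :: "(node \<Rightarrow> complex) \<Rightarrow> complex"
  assumes "\<And>x y. f (\<lambda>z. x z + y z) = f x + f y" "\<And>c x. f (\<lambda>z. c * x z) = cnj c * f x"
  shows "f x = (\<Sum>z\<in>UNIV. cnj (x z) * f (unit_at z))"
proof -
  have "cnj (f x) = (\<Sum>z\<in>UNIV. x z * cnj (f (unit_at z)))"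
    using assms by (intro linear_eq_sum_unit) simp_all
  from arg_cong[OF this, of cnj] show ?thesis by simp
qed

section \<open>The system matrix and the Galerkin problem\<close>

lemma system_matrix_mult:
  assumes \<alpha>: "0 < \<alpha>" "\<alpha> < 1"
  shows "(system_matrix \<alpha> k *v x) $ y = discrete_form \<alpha> k (\<lambda>z. x $ z) (unit_at y)"
proof -
  have u: "hat \<alpha> z \<circ> pos \<alpha> = unit_at z" for z
    by (rule ext) (simp add: hat_pos[OF \<alpha>] unit_at_def)
  have "(system_matrix \<alpha> k *v x) $ y = (\<Sum>z\<in>UNIV. x $ z * discrete_form \<alpha> k (unit_at z) (unit_at y))"
    by (simp add: matrix_vector_mult_def system_matrix_def helmholtz_form_eq[OF \<alpha>] hat_in_fe_space[OF \<alpha>] u mult.commute)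
  also have "\<dots> = discrete_form \<alpha> k (\<lambda>z. x $ z) (unit_at y)"
    by (rule linear_eq_sum_unit[symmetric]) (rule discrete_form_linear)+
  finally show ?thesis .
qed

lemma system_matrix_mult_eq_iff:
  assumes \<alpha>: "0 < \<alpha>" "\<alpha> < 1"
    and G: "\<And>x y. G (\<lambda>z. x z + y z) = G x + G y" "\<And>c x. G (\<lambda>z. c * x z) = cnj c * G x"
  shows "system_matrix \<alpha> k *v x = (\<chi> y. G (unit_at y)) \<longleftrightarrow> (\<forall>y. discrete_form \<alpha> k (\<lambda>z. x $ z) y = G y)"
proof
  assume *: "system_matrix \<alpha> k *v x = (\<chi> y. G (unit_at y))"
  have u: "discrete_form \<alpha> k (\<lambda>z. x $ z) (unit_at y) = G (unit_at y)" for y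
    using arg_cong[OF *, of "\<lambda>v. v $ y"] by (simp add: system_matrix_mult[OF \<alpha>])
  show "\<forall>y. discrete_form \<alpha> k (\<lambda>z. x $ z) y = G y"
  proof
    fix y
    have "discrete_form \<alpha> k (\<lambda>z. x $ z) y = (\<Sum>z\<in>UNIV. cnj (y z) * discrete_form \<alpha> k (\<lambda>z. x $ z) (unit_at z))"
      by (rule antilinear_eq_sum_unit) (rule discrete_form_linear)+
    also have "\<dots> = G y" unfolding u by (rule antilinear_eq_sum_unit[symmetric]) (rule G)+
    finally show "discrete_form \<alpha> k (\<lambda>z. x $ z) y = G y" .
  qed
qed (simp add: vec_eq_iff system_matrix_mult[OF \<alpha>])

lemma system_matrix_kernel:
  assumes \<alpha>: "0 < \<alpha>" "\<alpha> < 1" and k: "k \<noteq> 0"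
  shows "system_matrix \<alpha> k *v x = 0 \<longleftrightarrow>
    (\<exists>c. x = c *s (\<chi> z. alternating z) \<and> (c = 0 \<or> k = k_crit \<alpha> \<or> k = - k_crit \<alpha>))"
proof -
  have "system_matrix \<alpha> k *v x = 0 \<longleftrightarrow> (\<forall>y. discrete_form \<alpha> k (\<lambda>z. x $ z) y = 0)"
    using system_matrix_mult_eq_iff[OF \<alpha>, of "\<lambda>_. 0" k x] by (simp add: zero_vec_def)
  also have "\<dots> \<longleftrightarrow> (\<lambda>z. x $ z) = (\<lambda>z. x $ O1 * alternating z) \<and> (x $ O1 = 0 \<or> k = k_crit \<alpha> \<or> k = - k_crit \<alpha>)"
    by (rule discrete_form_kernel[OF \<alpha> k])
  also have "\<dots> \<longleftrightarrow> (\<exists>c. x = c *s (\<chi> z. alternating z) \<and> (c = 0 \<or> k = k_crit \<alpha> \<or> k = - k_crit \<alpha>))"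
  proof
    assume *: "(\<lambda>z. x $ z) = (\<lambda>z. x $ O1 * alternating z) \<and> (x $ O1 = 0 \<or> k = k_crit \<alpha> \<or> k = - k_crit \<alpha>)"
    then have "x $ z = x $ O1 * alternating z" for z by (rule fun_cong[OF conjunct1])
    then have "x = (x $ O1) *s (\<chi> z. alternating z)"
      unfolding vec_eq_iff vector_smult_component vec_lambda_beta by blast
    with * show "\<exists>c. x = c *s (\<chi> z. alternating z) \<and> (c = 0 \<or> k = k_crit \<alpha> \<or> k = - k_crit \<alpha>)" by blast
  qed (auto simp: alternating_def)
  finally show ?thesis .
qed

text \<open>
  A right-hand side is determined by its values on the hat functions, because it is antilinear. So
  the discrete problem for \<open>u\<close> is the linear system for its nodal values, and a square matrix with
  trivial kernel is invertible.
\<close>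

lemma galerkin_well_posed_if_injective:
  assumes \<alpha>: "0 < \<alpha>" "\<alpha> < 1" and inj: "\<And>x. system_matrix \<alpha> k *v x = 0 \<Longrightarrow> x = 0"
  shows "galerkin_well_posed \<alpha> k"
  unfolding galerkin_well_posed_def
proof (intro allI impI)
  fix F assume F: "antilinear_on (fe_space \<alpha>) F"
  define G where "G = (\<lambda>y. F (interpolant \<alpha> y))"
  have int: "interpolant \<alpha> y \<in> fe_space \<alpha>" for y by (rule interpolant_in_fe_space[OF \<alpha>])
  have G: "G (\<lambda>z. x z + y z) = G x + G y" "G (\<lambda>z. c * x z) = cnj c * G x" for x y c
  proof -
    have "interpolant \<alpha> (\<lambda>z. x z + y z) = (\<lambda>p. interpolant \<alpha> x p + interpolant \<alpha> y p)"
      by (simp add: interpolant_def fun_eq_iff sum.distrib algebra_simps)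
    then show "G (\<lambda>z. x z + y z) = G x + G y"
      using F int unfolding G_def antilinear_on_def by metis
    have "interpolant \<alpha> (\<lambda>z. c * x z) = (\<lambda>p. c * interpolant \<alpha> x p)"
      by (simp add: interpolant_def fun_eq_iff sum_distrib_left algebra_simps)
    then show "G (\<lambda>z. c * x z) = cnj c * G x"
      using F int unfolding G_def antilinear_on_def by metis
  qed
  have nodal: "u = interpolant \<alpha> (u \<circ> pos \<alpha>)" if "u \<in> fe_space \<alpha>" for u
    by (rule fe_space_eqI[OF \<alpha> that int]) (simp add: interpolant_pos[OF \<alpha>])
  have solves: "(\<forall>v\<in>fe_space \<alpha>. helmholtz_form k u v = F v) \<longleftrightarrow>
      system_matrix \<alpha> k *v (\<chi> z. u (pos \<alpha> z)) = (\<chi> y. G (unit_at y))" if u: "u \<in> fe_space \<alpha>" for u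
  proof -
    have "(\<forall>v\<in>fe_space \<alpha>. helmholtz_form k u v = F v) \<longleftrightarrow> (\<forall>y. discrete_form \<alpha> k (u \<circ> pos \<alpha>) y = G y)"
    proof
      assume *: "\<forall>v\<in>fe_space \<alpha>. helmholtz_form k u v = F v"
      have "interpolant \<alpha> y \<circ> pos \<alpha> = y" for y by (rule ext) (simp add: interpolant_pos[OF \<alpha>])
      with * show "\<forall>y. discrete_form \<alpha> k (u \<circ> pos \<alpha>) y = G y"
        using helmholtz_form_eq[OF \<alpha> u int] int unfolding G_def by metis
    next
      assume *: "\<forall>y. discrete_form \<alpha> k (u \<circ> pos \<alpha>) y = G y"
      show "\<forall>v\<in>fe_space \<alpha>. helmholtz_form k u v = F v"
      proof
        fix v assume v: "v \<in> fe_space \<alpha>"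
        have "helmholtz_form k u v = G (v \<circ> pos \<alpha>)" using * by (simp add: helmholtz_form_eq[OF \<alpha> u v])
        then show "helmholtz_form k u v = F v" using nodal[OF v] by (simp add: G_def)
      qed
    qed
    also have "\<dots> \<longleftrightarrow> system_matrix \<alpha> k *v (\<chi> z. u (pos \<alpha> z)) = (\<chi> y. G (unit_at y))"
      using system_matrix_mult_eq_iff[where G = G, OF \<alpha> G, where k = k and x = "\<chi> z. u (pos \<alpha> z)"] by (simp add: o_def)
    finally show ?thesis .
  qed
  have "invertible (system_matrix \<alpha> k)"
    unfolding invertible_left_inverse matrix_left_invertible_ker using inj by blast
  then obtain B where B: "system_matrix \<alpha> k ** B = mat 1" unfolding invertible_def by blast
  define x where "x = B *v (\<chi> y. G (unit_at y))"
  have x: "system_matrix \<alpha> k *v x = (\<chi> y. G (unit_at y))"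
    unfolding x_def by (simp add: matrix_vector_mul_assoc B)
  show "\<exists>!u. u \<in> fe_space \<alpha> \<and> (\<forall>v\<in>fe_space \<alpha>. helmholtz_form k u v = F v)"
  proof (rule ex1I[of _ "interpolant \<alpha> (\<lambda>z. x $ z)"])
    show "interpolant \<alpha> (\<lambda>z. x $ z) \<in> fe_space \<alpha> \<and>
      (\<forall>v\<in>fe_space \<alpha>. helmholtz_form k (interpolant \<alpha> (\<lambda>z. x $ z)) v = F v)"
      using solves[OF int] x int by (simp add: interpolant_pos[OF \<alpha>])
    fix u assume u: "u \<in> fe_space \<alpha> \<and> (\<forall>v\<in>fe_space \<alpha>. helmholtz_form k u v = F v)"
    then have "system_matrix \<alpha> k *v (\<chi> z. u (pos \<alpha> z)) = system_matrix \<alpha> k *v x"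
      using solves[of u] unfolding x by blast
    then have "system_matrix \<alpha> k *v ((\<chi> z. u (pos \<alpha> z)) - x) = 0"
      by (simp add: matrix_vector_mult_diff_distrib)
    then have "(\<chi> z. u (pos \<alpha> z)) = x" using inj by fastforce
    then have "u \<circ> pos \<alpha> = (\<lambda>z. x $ z)" by (auto simp: fun_eq_iff)
    then show "u = interpolant \<alpha> (\<lambda>z. x $ z)" using nodal u by metis
  qed
qed

theorem lemma3p4:
  fixes \<alpha> :: real
  assumes "0 < \<alpha>" and "\<alpha> < 1"
  shows "(\<forall>k::real. k \<noteq> 0 \<and> k \<noteq> k_crit \<alpha> \<and> k \<noteq> - k_crit \<alpha> \<longrightarrow> galerkin_well_posed \<alpha> k) \<and>
    (\<forall>k::real. k = k_crit \<alpha> \<or> k = - k_crit \<alpha> \<longrightarrow>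
      \<not> invertible (system_matrix \<alpha> k) \<and>
      vec.dim {x :: complex ^ node. system_matrix \<alpha> k *v x = 0} = 1)"
proof (intro conjI allI impI)
  fix k :: real
  assume "k \<noteq> 0 \<and> k \<noteq> k_crit \<alpha> \<and> k \<noteq> - k_crit \<alpha>"
  then show "galerkin_well_posed \<alpha> k"
    using system_matrix_kernel[OF assms] by (intro galerkin_well_posed_if_injective[OF assms]) auto
next
  fix k :: real
  assume k: "k = k_crit \<alpha> \<or> k = - k_crit \<alpha>"
  let ?e = "\<chi> z. alternating z"
  have "k \<noteq> 0" using k k_crit_pos[OF assms] by auto
  with k have kernel: "{x. system_matrix \<alpha> k *v x = 0} = range (\<lambda>c. c *s ?e)"
    using system_matrix_kernel[OF assms] by auto
  have e: "?e \<noteq> 0" by (auto simp: vec_eq_iff alternating_def intro!: exI[of _ O1])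
  have "system_matrix \<alpha> k *v ?e = 0"
    using kernel by (metis (mono_tags, lifting) mem_Collect_eq rangeI vec.scale_one)
  with e show "\<not> invertible (system_matrix \<alpha> k)"
    unfolding invertible_left_inverse matrix_left_invertible_ker by blast
  have "vec.dim (vec.span {?e}) = card {?e}"
    by (rule vec.dim_span_eq_card_independent) (simp add: e)
  then show "vec.dim {x. system_matrix \<alpha> k *v x = 0} = 1"
    unfolding kernel by (simp add: vec.span_singleton)
qed
end
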